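(* Let $F:\ell^p\to Y$ be Fréchet differentiable on $\ell^p$ and suppose: (i) there is $L>0$ with $\|F'(x)-F'(z)\|_{\mathcal L(\ell^p,Y)}\le L\|x-z\|$ for all $x,z\in\ell^p$; (ii) there is $c>0$ with $\|F(x)-F(z)-F'(z)(x-z)\|\le c\,D_{f_p}(x,z)$ for all $x,z\in\ell^p$; (iii) there are $s>2$, $0<\varrho<\frac1{sc}$, an $f_p$-minimizing solution $x^\dagger$ and $\omega\in Y$ with $\|\omega\|\le\varrho$ and $J_p(x^\dagger)=F'(x^\dagger)^*\omega$. Let $\bar x_0\in\ell^p$ and $\alpha_0>\alpha^*$ with $D_{f_p}(x_{\alpha_0}^\delta,\bar x_0)\le d_{\alpha_0}$, and let $\bar q\in(\bar q_0,1)$ satisfy $\rho\,\sigma\,\alpha_0(1-\bar q)\le\min\{d_{\alpha^*}/3,\,1\}$. Let $\alpha_j\in[\alpha^*,\alpha_0]$, put $\alpha_{j+1}:=\max\{\bar q\alpha_j,\alpha^*\}$, and suppose $x_{j,0}\in\mathcal B_{d_{\alpha_j}}(x_{\alpha_j}^\delta)$. Then there is a constant $M_{\alpha_j}>0$ such that the following holds for the sequence $\{x_{j,k}\}_{k\ge0}$ generated from $x_{j,0}$ by $$J_p(x_{j,k+1})=J_p(x_{j,k})-\beta_{j,k}\nabla\Phi_{\alpha_j}(x_{j,k}),\qquad x_{j,k+1}=J_q(J_p(x_{j,k+1})),$$ with step-sizes $\beta_{j,k}=\min\left\{\frac{\gamma\,\bar c_{j,k}\,\alpha_j}{\|\nabla\Phi_{\alpha_j}(x_{j,k})\|^2},\frac1{2M_{\alpha_j}}\right\}$: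 if $x_{j,k^*}$ is the first iterate satisfying $$\|\nabla\Phi_{\alpha_j}(x_{j,k^*})\|\le C_{\alpha_j},\qquad\text{where }\ 0<C_{\alpha_j}\le\frac{\gamma\,\alpha_j\,d_{\alpha_{j+1}}}{3\,r_{\alpha_j}},$$ then $x_{j,k^*}\in\mathcal B_{d_{\alpha_{j+1}}}(x_{\alpha_{j+1}}^\delta)$.
   Context: Fix $1<p\le2$ and $q$ with $\frac1p+\frac1q=1$. $\ell^p=\ell^p(\mathbb N)$ is the real sequence space with dual $\ell^q$ and duality product $\langle\cdot,\cdot\rangle$; $Y$ is a real Hilbert space; all norms are written $\|\cdot\|$. $F:\ell^p\to Y$ is a nonlinear operator that is sequentially closed with respect to the weak topologies of $\ell^p$ and $Y$. Let $y\in\mathrm{Rg}(F)$, $\delta>0$, and fix $y^\delta\in Y$ with $\|y-y^\delta\|\le\delta$. $f_p(x)=\frac1p\|x\|_{\ell^p}^p$; $J_p(x)=\nabla f_p(x)=(|x_i|^{p-1}\mathrm{sgn}(x_i))_{i}\in\ell^q$, with inverse $J_q:\ell^q\to\ell^p$, $J_q(\xi)=(|\xi_i|^{q-1}\mathrm{sgn}(\xi_i))_i$; Bregman distance $D_{f_p}(z,x)=f_p(z)-f_p(x)-\langle J_p(x),z-x\rangle$. An $f_p$-minimizing solution $x^\dagger$ is an element with $F(x^\dagger)=y$ and $f_p(x^\dagger)=\min\{f_p(x):F(x)=y\}$. $\tilde c_p>0$ is a constant such that $D_{f_p}(z,x)\le\tilde c_p\|x-z\|^p$ for all $x,z\in\ell^p$.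 For $\alpha>0$: $\Phi_\alpha(x)=\frac12\|F(x)-y^\delta\|^2+\frac{\alpha}{p}\|x\|_{\ell^p}^p$, $\nabla\Phi_\alpha(x)=F'(x)^*(F(x)-y^\delta)+\alpha J_p(x)\in\ell^q$, and $x_\alpha^\delta$ denotes a global minimizer of $\Phi_\alpha$ over $\ell^p$. With the constants of the claim: $\alpha^*:=\frac{\delta}{(s-2)\varrho}$, $A:=\left(\frac{p}{2\alpha^*}\right)^{1/p}\|F(0)-y^\delta\|^{2/p}$, $K:=LA+\|F'(0)\|$, $\gamma:=\frac{1-sc\varrho}{2}$, and for $\alpha\ge\alpha^*$, $r_\alpha:=\frac{2}{1+\sqrt2}\min\left\{\frac{\gamma\alpha}{3cK},\sqrt{\frac{\gamma\alpha}{10cL}}\right\}$ (with $\gamma\alpha/(3cK)$ read as $+\infty$ if $K=0$). Further $\bar q_0:=\frac{2sc\varrho}{1+sc\varrho}$, $c_A:=\frac{p-1}{2}(3A)^{p-2}$, $\sigma:=\frac{2s\varrho K}{c_A(1-sc\varrho)\alpha^*}$ (read as $0$ if $A=0$ and $p<2$), $\rho:=\max\{\tilde c_p^{1/p},\ 2A^{p-1}+r_{\alpha_0}^{p-1}\}$. Notation: $B_r(x)=\{z\in\ell^p:\|z-x\|\le r\}$ and $\mathcal B_d(z)=\{x\in\ell^p:D_{f_p}(z,x)\le d\}$. Fix a function $\alpha\mapsto d_\alpha>0$ on $[\alpha^*,\infty)$ that is continuous, strictly increasing, satisfies $d_\alpha\to\infty$ as $\alpha\to\infty$, and $\mathcal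 B_{d_\alpha}(x_\alpha^\delta)\subset B_{r_\alpha}(x_\alpha^\delta)$ for all $\alpha\ge\alpha^*$ (such a function exists). Step-size quantities: $\bar c_A:=\frac{p-1}{2}(2r_{\alpha_j}+A)^{p-2}$, $\phi_{j,k}:=\min\{\Phi_{\alpha_j}(J_q(J_p(x_{j,k})-t\nabla\Phi_{\alpha_j}(x_{j,k}))):t\ge0\}$, and $$\bar c_{j,k}:=\min\left\{1,\ \frac{8\bar c_A(\Phi_{\alpha_j}(x_{j,k})-\phi_{j,k})}{4K^2+4Ls\varrho\alpha_j+4LKr_{\alpha_j}+L^2r_{\alpha_j}^2+8\alpha_j\tilde c_p\bar c_A^{(2-p)/2}}\right\}.$$ If $\nabla\Phi_{\alpha_j}(x_{j,k})=0$, then $x_{j,k+1}=x_{j,k}$ and $\beta_{j,k}$ is irrelevant. *)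

theory Defs
  imports "HOL-Analysis.Analysis"
begin

text \<open>
  The exponent of a sequence space is a real number, so \<open>\<ell>\<^sup>p\<close> is represented by a carrier set of
  real sequences. Operators on \<open>\<ell>\<^sup>p\<close> are total functions on \<open>nat \<Rightarrow> real\<close> of which only the
  values on the carrier matter.
\<close>

definition lp :: "real \<Rightarrow> (nat \<Rightarrow> real) set" where
  "lp p = {x. summable (\<lambda>i. \<bar>x i\<bar> powr p)}"

definition lp_norm :: "real \<Rightarrow> (nat \<Rightarrow> real) \<Rightarrow> real" where
  "lp_norm p x = (\<Sum>i. \<bar>x i\<bar> powr p) powr (1 / p)"

definition lp_cball :: "real \<Rightarrow> (nat \<Rightarrow> real) \<Rightarrow> real \<Rightarrow> (nat \<Rightarrow> real) set" where
  "lp_cball p x r = {z \<in> lp p. lp_norm p (z - x) \<le> r}"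

definition lp_pair :: "(nat \<Rightarrow> real) \<Rightarrow> (nat \<Rightarrow> real) \<Rightarrow> real" where
  "lp_pair \<xi> x = (\<Sum>i. \<xi> i * x i)"

definition lp_weakly_tendsto :: "real \<Rightarrow> (nat \<Rightarrow> nat \<Rightarrow> real) \<Rightarrow> (nat \<Rightarrow> real) \<Rightarrow> bool" where
  "lp_weakly_tendsto q X x \<longleftrightarrow> (\<forall>\<xi>\<in>lp q. (\<lambda>n. lp_pair \<xi> (X n)) \<longlonglongrightarrow> lp_pair \<xi> x)"

definition hilbert_weakly_tendsto :: "(nat \<Rightarrow> 'y::real_inner) \<Rightarrow> 'y \<Rightarrow> bool" where
  "hilbert_weakly_tendsto V v \<longleftrightarrow> (\<forall>w. (\<lambda>n. w \<bullet> V n) \<longlonglongrightarrow> w \<bullet> v)"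

definition lp_weakly_seq_closed ::
    "real \<Rightarrow> real \<Rightarrow> ((nat \<Rightarrow> real) \<Rightarrow> 'y::real_inner) \<Rightarrow> bool" where
  "lp_weakly_seq_closed p q F \<longleftrightarrow>
     (\<forall>X x v. (\<forall>n. X n \<in> lp p) \<longrightarrow> x \<in> lp p \<longrightarrow> lp_weakly_tendsto q X x \<longrightarrow>
        hilbert_weakly_tendsto (\<lambda>n. F (X n)) v \<longrightarrow> F x = v)"

definition lp_bounded_linear :: "real \<Rightarrow> ((nat \<Rightarrow> real) \<Rightarrow> 'y::real_normed_vector) \<Rightarrow> bool" where
  "lp_bounded_linear p T \<longleftrightarrow>
     (\<forall>x\<in>lp p. \<forall>z\<in>lp p. \<forall>a b. T (\<lambda>i. a * x i + b * z i) = a *\<^sub>R T x + b *\<^sub>R T z) \<and>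
     (\<exists>B. \<forall>x\<in>lp p. norm (T x) \<le> B * lp_norm p x)"

definition lp_onorm :: "real \<Rightarrow> ((nat \<Rightarrow> real) \<Rightarrow> 'y::real_normed_vector) \<Rightarrow> real" where
  "lp_onorm p T = (SUP h\<in>{h \<in> lp p. lp_norm p h \<le> 1}. norm (T h))"

definition lp_has_derivative ::
    "real \<Rightarrow> ((nat \<Rightarrow> real) \<Rightarrow> 'y::real_normed_vector) \<Rightarrow> ((nat \<Rightarrow> real) \<Rightarrow> 'y) \<Rightarrow> (nat \<Rightarrow> real) \<Rightarrow> bool"
  where
  "lp_has_derivative p F T x \<longleftrightarrow> lp_bounded_linear p T \<and>
     (\<forall>\<epsilon>>0. \<exists>\<eta>>0. \<forall>z\<in>lp p. lp_norm p (z - x) < \<eta> \<longrightarrow>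
        norm (F z - F x - T (z - x)) \<le> \<epsilon> * lp_norm p (z - x))"

definition lp_adjoint ::
    "real \<Rightarrow> real \<Rightarrow> ((nat \<Rightarrow> real) \<Rightarrow> 'y::real_inner) \<Rightarrow> 'y \<Rightarrow> (nat \<Rightarrow> real)" where
  "lp_adjoint p q T w = (THE \<xi>. \<xi> \<in> lp q \<and> (\<forall>h\<in>lp p. lp_pair \<xi> h = w \<bullet> T h))"

definition fp :: "real \<Rightarrow> (nat \<Rightarrow> real) \<Rightarrow> real" where
  "fp p x = (1 / p) * lp_norm p x powr p"

definition dualmap :: "real \<Rightarrow> (nat \<Rightarrow> real) \<Rightarrow> (nat \<Rightarrow> real)" where
  "dualmap p x = (\<lambda>i. \<bar>x i\<bar> powr (p - 1) * sgn (x i))"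

definition bregman :: "real \<Rightarrow> (nat \<Rightarrow> real) \<Rightarrow> (nat \<Rightarrow> real) \<Rightarrow> real" where
  "bregman p z x = fp p z - fp p x - lp_pair (dualmap p x) (z - x)"

text \<open>The centre of a Bregman ball is the first argument of the distance.\<close>

definition bregman_ball :: "real \<Rightarrow> (nat \<Rightarrow> real) \<Rightarrow> real \<Rightarrow> (nat \<Rightarrow> real) set" where
  "bregman_ball p z d = {x \<in> lp p. bregman p z x \<le> d}"

definition fp_minimizing_solution ::
    "real \<Rightarrow> ((nat \<Rightarrow> real) \<Rightarrow> 'y) \<Rightarrow> 'y \<Rightarrow> (nat \<Rightarrow> real) \<Rightarrow> bool" where
  "fp_minimizing_solution p F y x \<longleftrightarrow>
     x \<in> lp p \<and> F x = y \<and> (\<forall>z\<in>lp p. F z = y \<longrightarrow> fp p x \<le> fp p z)"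

definition tikhonov ::
    "real \<Rightarrow> ((nat \<Rightarrow> real) \<Rightarrow> 'y::real_normed_vector) \<Rightarrow> 'y \<Rightarrow> real \<Rightarrow> (nat \<Rightarrow> real) \<Rightarrow> real" where
  "tikhonov p F yd \<alpha> x = (1 / 2) * (norm (F x - yd))\<^sup>2 + (\<alpha> / p) * lp_norm p x powr p"

definition tikhonov_grad ::
    "real \<Rightarrow> real \<Rightarrow> ((nat \<Rightarrow> real) \<Rightarrow> 'y::real_inner) \<Rightarrow> ((nat \<Rightarrow> real) \<Rightarrow> (nat \<Rightarrow> real) \<Rightarrow> 'y) \<Rightarrow>
     'y \<Rightarrow> real \<Rightarrow> (nat \<Rightarrow> real) \<Rightarrow> (nat \<Rightarrow> real)" where
  "tikhonov_grad p q F F' yd \<alpha> x =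
     (\<lambda>i. lp_adjoint p q (F' x) (F x - yd) i + \<alpha> * dualmap p x i)"

definition tikhonov_minimizer ::
    "real \<Rightarrow> ((nat \<Rightarrow> real) \<Rightarrow> 'y::real_normed_vector) \<Rightarrow> 'y \<Rightarrow> real \<Rightarrow> (nat \<Rightarrow> real) \<Rightarrow> bool" where
  "tikhonov_minimizer p F yd \<alpha> x \<longleftrightarrow>
     x \<in> lp p \<and> (\<forall>z\<in>lp p. tikhonov p F yd \<alpha> x \<le> tikhonov p F yd \<alpha> z)"

text \<open>
  The minimum of the functional along the dual gradient ray. It is attained for \<open>\<alpha> > 0\<close> and
  differentiable \<open>F\<close>, because the functional is continuous and coercive, so the infimum below is
  a minimum.
\<close>

definition tikhonov_linemin ::
    "real \<Rightarrow> real \<Rightarrow> ((nat \<Rightarrow> real) \<Rightarrow> 'y::real_inner) \<Rightarrow> ((nat \<Rightarrow> real) \<Rightarrow> (nat \<Rightarrow> real) \<Rightarrow> 'y) \<Rightarrow>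
     'y \<Rightarrow> real \<Rightarrow> (nat \<Rightarrow> real) \<Rightarrow> real" where
  "tikhonov_linemin p q F F' yd \<alpha> x =
     (INF t\<in>{0..}. tikhonov p F yd \<alpha>
        (dualmap q (\<lambda>i. dualmap p x i - t * tikhonov_grad p q F F' yd \<alpha> x i)))"

text \<open>
  One run of the dual gradient iteration with step sizes
  \<open>min {\<gamma> * cbar (x k) * \<alpha> / \<parallel>grad\<parallel>\<^sup>2, 1 / (2 * M)}\<close>. Where the gradient vanishes the quotient is
  \<open>0\<close> by the convention on division, and the recursion yields \<open>x (Suc k) = x k\<close> for any step size.
\<close>

definition dual_gradient_iteration ::
    "real \<Rightarrow> real \<Rightarrow> ((nat \<Rightarrow> real) \<Rightarrow> (nat \<Rightarrow> real)) \<Rightarrow> real \<Rightarrow> ((nat \<Rightarrow> real) \<Rightarrow> real) \<Rightarrow> real \<Rightarrow> real \<Rightarrow>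
     (nat \<Rightarrow> nat \<Rightarrow> real) \<Rightarrow> bool" where
  "dual_gradient_iteration p q grad \<gamma> cbar \<alpha> M x \<longleftrightarrow>
     (\<forall>k. let \<beta> = min (\<gamma> * cbar (x k) * \<alpha> / (lp_norm q (grad (x k)))\<^sup>2) (1 / (2 * M)) in
        dualmap p (x (Suc k)) = (\<lambda>i. dualmap p (x k) i - \<beta> * grad (x k) i) \<and>
        x (Suc k) = dualmap q (dualmap p (x (Suc k))))"

end

theory Submission
  imports Defs
begin

text \<open>
  Let \<open>a = \<alpha>j\<close>, \<open>b = \<alpha>j1\<close>. At a minimizer the residual is at most \<open>s * varrho * \<alpha>\<close> by the source
  condition, so the nonlinearity bound makes the functional grow like \<open>2 * \<gamma> * \<alpha>\<close> times the Bregman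
  distance from it, and on the ball of radius \<open>r a\<close> the gradient satisfies
  \<open>\<gamma> * a * D (x_a, x) \<le> \<langle>grad x, x - x_a\<rangle>\<close>. Hence a sufficiently short dual gradient step
  leaves the Bregman ball around \<open>x_a\<close> invariant, and a small gradient forces \<open>D (x_a, x) \<le> d b / 3\<close>.
  Adding the growth inequalities for \<open>a\<close> and \<open>b\<close> and using the monotonicity of the duality map
  bounds \<open>\<parallel>x_b - x_a\<parallel>\<close> by \<open>\<sigma> * (a - b)\<close>, so that moving the centre costs at most \<open>2 * d b / 3\<close>.
  A large \<open>M\<close> makes every step with a nonnegative factor \<open>cbar\<close> short enough.
\<close>

subsection \<open>Hoelder and Minkowski inequalities for sequences\<close>

text \<open>The Bregman distance is not symmetric: growth at a minimizer \<open>z\<close> controls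
  \<open>bregman p x z\<close>, whereas the balls measure \<open>bregman p z x\<close>. The gradient
  estimate therefore works with the sum of both orientations, which is the pairing of
  \<open>dualmap p x - dualmap p z\<close> with \<open>x - z\<close>, and spends part of it on error
  terms. For \<open>p < 2\<close> the distance does not dominate the squared norm globally. The
  substitute is \<open>dualmap_monotone\<close>, whose factor, the sum of the two norms to the power
  \<open>2 - p\<close>, is harmless only on bounded sets; this is why bounds such as
  \<open>A\<close> for the minimizers, \<open>r\<close> for the ball and \<open>G\<close> for the
  gradients are needed. It yields both the Lipschitz dependence of the minimizers on \<alpha> and a
  step error of order \<open>\<beta>\<^sup>2\<close>. The threshold \<open>\<alpha>s\<close> is the
  point from which on \<delta> is at most \<open>(s - 2) * varrho * \<alpha>\<close>. The thirds in
  the hypotheses match the three terms of the three-point identity.\<close>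

lemma Youngs_inequality_nonneg:
  fixes a b :: real
  assumes "0 \<le> \<theta>" "0 \<le> \<eta>" "\<theta> + \<eta> = 1" "0 \<le> a" "0 \<le> b"
  shows "a powr \<theta> * b powr \<eta> \<le> \<theta> * a + \<eta> * b"
proof (cases "a = 0 \<or> b = 0")
  \<comment> \<open>\<open>0 powr e = 0\<close> holds even for \<open>e = 0\<close>, so a vanishing
    factor makes the left side zero for every weight.\<close>
  case True
  then show ?thesis using assms by auto
next
  case False
  then show ?thesis using Youngs_inequality_0[of \<theta> \<eta> a b] assms by auto
qed

text \<open>Hoelder's inequality with weights in place of conjugate exponents: normalise both sums
  to one and apply Young termwise. Zero weights are allowed, which covers \<open>p = 2\<close> in
  \<open>dualmap_monotone\<close>, where one weight is \<open>(2 - p) / 2\<close>.\<close>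

lemma
  fixes a b :: "nat \<Rightarrow> real"
  assumes nn: "\<And>i. 0 \<le> a i" "\<And>i. 0 \<le> b i" and sm: "summable a" "summable b"
    and e: "0 \<le> \<theta>" "0 \<le> \<eta>" "\<theta> + \<eta> = 1"
  shows summable_powr_mult: "summable (\<lambda>i. a i powr \<theta> * b i powr \<eta>)"
    and suminf_powr_mult_le:
      "(\<Sum>i. a i powr \<theta> * b i powr \<eta>) \<le> suminf a powr \<theta> * suminf b powr \<eta>"
proof -
  have "summable (\<lambda>i. \<theta> * a i + \<eta> * b i)"
    by (intro summable_add summable_mult sm)
  then show S: "summable (\<lambda>i. a i powr \<theta> * b i powr \<eta>)"
    by (rule summable_comparison_test'[where N = 0])
       (use nn e in \<open>auto intro: Youngs_inequality_nonneg\<close>)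
  show "(\<Sum>i. a i powr \<theta> * b i powr \<eta>) \<le> suminf a powr \<theta> * suminf b powr \<eta>"
  proof (cases "suminf a = 0 \<or> suminf b = 0")
    case True
    then have "(\<forall>i. a i = 0) \<or> (\<forall>i. b i = 0)"
      using suminf_eq_zero_iff[OF sm(1) nn(1)] suminf_eq_zero_iff[OF sm(2) nn(2)] by blast
    then have "(\<lambda>i. a i powr \<theta> * b i powr \<eta>) = (\<lambda>_. 0)" by auto
    then show ?thesis by simp
  next
    case False
    define P Q where "P = suminf a" and "Q = suminf b"
    have PQ: "P > 0" "Q > 0"
      using False suminf_nonneg[OF sm(1) nn(1)] suminf_nonneg[OF sm(2) nn(2)]
      by (auto simp: P_def Q_def)
    define C where "C = P powr \<theta> * Q powr \<eta>"
    have "C > 0" using PQ by (simp add: C_def)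
    have pt: "a i powr \<theta> * b i powr \<eta> \<le> C * (\<theta> / P * a i + \<eta> / Q * b i)" for i
    proof -
      have "(a i / P) powr \<theta> * (b i / Q) powr \<eta> \<le> \<theta> * (a i / P) + \<eta> * (b i / Q)"
        using e nn PQ by (intro Youngs_inequality_nonneg) auto
      moreover have "(a i / P) powr \<theta> * (b i / Q) powr \<eta> = a i powr \<theta> * b i powr \<eta> / C"
        using nn PQ by (simp add: powr_divide C_def)
      ultimately show ?thesis
        using \<open>C > 0\<close> by (simp add: field_simps)
    qed
    have sm': "summable (\<lambda>i. \<theta> / P * a i + \<eta> / Q * b i)"
      by (intro summable_add summable_mult sm)
    have "(\<Sum>i. a i powr \<theta> * b i powr \<eta>) \<le> (\<Sum>i. C * (\<theta> / P * a i + \<eta> / Q * b i))"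
      by (intro suminf_le pt S summable_mult sm')
    also have "\<dots> = C * (\<theta> / P * P + \<eta> / Q * Q)"
      unfolding P_def Q_def
      by (intro sums_unique[symmetric] sums_mult sums_add summable_sums sm)
    also have "\<dots> = C" using PQ e by simp
    finally show ?thesis by (simp add: C_def P_def Q_def)
  qed
qed

lemma powr_le_imp_le_base:
  fixes x y :: real
  assumes "x powr p \<le> y powr p" "0 < p" "0 \<le> x" "0 \<le> y"
  shows "x \<le> y"
  using assms powr_less_mono2[of p y x] by linarith

lemma powr_convex_combination:
  fixes a b :: real
  assumes "1 \<le> p" "0 \<le> a" "0 \<le> b" "0 \<le> u" "0 \<le> v" "u + v = 1"
  shows "(u * a + v * b) powr p \<le> u * a powr p + v * b powr p"
proof (cases "a = 0 \<or> b = 0")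
  case True
  have *: "(w * x) powr p \<le> w * x powr p" if "0 \<le> w" "w \<le> 1" "0 \<le> x" for w x :: real
  proof -
    have "w powr p \<le> w"
      using that assms(1) powr_mono'[of 1 p w] by simp
    then show ?thesis using that by (simp add: powr_mult mult_right_mono)
  qed
  show ?thesis using True *[of u a] *[of v b] assms by auto
next
  case False
  then show ?thesis
    using powr_convex[OF assms(1)] assms by (auto simp: convex_on_def)
qed

section \<open>Membership and norm in the sequence spaces\<close>

lemma lp_norm_nonneg [simp]: "0 \<le> lp_norm p x"
  by (simp add: lp_norm_def)

lemma lp_suminf_nonneg: "x \<in> lp p \<Longrightarrow> 0 \<le> (\<Sum>i. \<bar>x i\<bar> powr p)"
  by (auto simp: lp_def intro: suminf_nonneg)

lemma lp_norm_powr: "x \<in> lp p \<Longrightarrow> 0 < p \<Longrightarrow> lp_norm p x powr p = (\<Sum>i. \<bar>x i\<bar> powr p)"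
  using lp_suminf_nonneg[of x p] by (simp add: lp_norm_def powr_powr)

lemma lp_norm_eq_0_iff:
  assumes "x \<in> lp p"
  shows "lp_norm p x = 0 \<longleftrightarrow> (\<forall>i. x i = 0)"
  using assms suminf_eq_zero_iff[of "\<lambda>i. \<bar>x i\<bar> powr p"] by (auto simp: lp_norm_def lp_def)

lemma zero_in_lp [simp]: "(\<lambda>_. 0) \<in> lp p"
  by (simp add: lp_def)

lemma lp_norm_zero [simp]: "lp_norm p (\<lambda>_. 0) = 0"
  by (simp add: lp_norm_def)

lemma lp_scale: "x \<in> lp p \<Longrightarrow> (\<lambda>i. a * x i) \<in> lp p"
  by (auto simp: lp_def abs_mult powr_mult intro: summable_mult)

lemma lp_norm_scale:
  assumes "x \<in> lp p" "p > 0"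
  shows "lp_norm p (\<lambda>i. a * x i) = \<bar>a\<bar> * lp_norm p x"
proof -
  have "(\<Sum>i. \<bar>a * x i\<bar> powr p) = \<bar>a\<bar> powr p * (\<Sum>i. \<bar>x i\<bar> powr p)"
    using assms by (simp add: abs_mult powr_mult suminf_mult lp_def)
  then show ?thesis
    using assms by (simp add: lp_norm_def powr_mult powr_powr)
qed

text \<open>Minkowski from convexity of the power: with \<open>u\<close> and \<open>v\<close> the
  shares of the two norms in their sum, the entries of \<open>x + z\<close> are at most
  \<open>a + b\<close> times a convex combination of the normalised entries.\<close>

lemma
  assumes "x \<in> lp p" "z \<in> lp p" "1 \<le> p"
  shows lp_add: "(\<lambda>i. x i + z i) \<in> lp p"
    and lp_norm_triangle: "lp_norm p (\<lambda>i. x i + z i) \<le> lp_norm p x + lp_norm p z"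
proof -
  define a b where "a = lp_norm p x" and "b = lp_norm p z"
  have ab: "0 \<le> a" "0 \<le> b" by (auto simp: a_def b_def)
  have sm: "summable (\<lambda>i. \<bar>x i\<bar> powr p)" "summable (\<lambda>i. \<bar>z i\<bar> powr p)"
    using assms by (auto simp: lp_def)
  \<comment> \<open>A crude midpoint bound secures summability first, which the comparison of sums
    below presupposes.\<close>
  have pt1: "\<bar>x i + z i\<bar> powr p \<le> 2 powr p * (1/2 * \<bar>x i\<bar> powr p + 1/2 * \<bar>z i\<bar> powr p)" for i
  proof -
    have "\<bar>x i + z i\<bar> powr p \<le> (2 * (1/2 * \<bar>x i\<bar> + 1/2 * \<bar>z i\<bar>)) powr p"
      using assms by (intro powr_mono2) auto
    also have "\<dots> = 2 powr p * (1/2 * \<bar>x i\<bar> + 1/2 * \<bar>z i\<bar>) powr p"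
      by (subst powr_mult) auto
    also have "\<dots> \<le> 2 powr p * (1/2 * \<bar>x i\<bar> powr p + 1/2 * \<bar>z i\<bar> powr p)"
      using assms by (intro mult_left_mono powr_convex_combination) auto
    finally show ?thesis .
  qed
  have sm1: "summable (\<lambda>i. \<bar>x i + z i\<bar> powr p)"
    by (rule summable_comparison_test'[where N = 0,
          where g = "\<lambda>i. 2 powr p * (1/2 * \<bar>x i\<bar> powr p + 1/2 * \<bar>z i\<bar> powr p)"])
       (use pt1 in \<open>auto intro!: summable_mult summable_add sm\<close>)
  then show mem: "(\<lambda>i. x i + z i) \<in> lp p" by (simp add: lp_def)
  show "lp_norm p (\<lambda>i. x i + z i) \<le> a + b"
  proof (cases "a = 0 \<or> b = 0")
    case True
    then have "(\<forall>i. x i = 0) \<or> (\<forall>i. z i = 0)"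
      using lp_norm_eq_0_iff assms by (auto simp: a_def b_def)
    then show ?thesis using ab by (auto simp: a_def b_def)
  next
    case False
    then have pos: "0 < a" "0 < b" "0 < a + b" using ab by auto
    define u v where "u = a / (a + b)" and "v = b / (a + b)"
    have uv: "0 \<le> u" "0 \<le> v" "u + v = 1"
      using pos by (auto simp: u_def v_def simp flip: add_divide_distrib)
    have pt: "\<bar>x i + z i\<bar> powr p
        \<le> (a + b) powr p * (u / a powr p * \<bar>x i\<bar> powr p + v / b powr p * \<bar>z i\<bar> powr p)" for i
    proof -
      have "\<bar>x i + z i\<bar> powr p \<le> ((a + b) * (u * (\<bar>x i\<bar> / a) + v * (\<bar>z i\<bar> / b))) powr p"
      proof -
        have "(a + b) * (u * (\<bar>x i\<bar> / a) + v * (\<bar>z i\<bar> / b)) = \<bar>x i\<bar> + \<bar>z i\<bar>"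
          using pos by (simp add: u_def v_def distrib_left)
        then show ?thesis using assms by (intro powr_mono2) auto
      qed
      also have "\<dots> = (a + b) powr p * (u * (\<bar>x i\<bar> / a) + v * (\<bar>z i\<bar> / b)) powr p"
        using pos uv by (subst powr_mult) auto
      also have "\<dots> \<le> (a + b) powr p * (u * (\<bar>x i\<bar> / a) powr p + v * (\<bar>z i\<bar> / b) powr p)"
        using assms pos uv by (intro mult_left_mono powr_convex_combination) auto
      finally show ?thesis using pos by (simp add: powr_divide)
    qed
    have sm': "summable (\<lambda>i. u / a powr p * \<bar>x i\<bar> powr p + v / b powr p * \<bar>z i\<bar> powr p)"
      by (intro summable_add summable_mult sm)
    have "lp_norm p (\<lambda>i. x i + z i) powr p
        = (\<Sum>i. \<bar>x i + z i\<bar> powr p)"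
      using lp_norm_powr[OF mem] assms by simp
    also have "\<dots> \<le> (\<Sum>i. (a + b) powr p *
        (u / a powr p * \<bar>x i\<bar> powr p + v / b powr p * \<bar>z i\<bar> powr p))"
      by (intro suminf_le pt sm1 summable_mult sm')
    also have "\<dots> = (a + b) powr p * (u / a powr p * a powr p + v / b powr p * b powr p)"
    proof -
      have "a powr p = (\<Sum>i. \<bar>x i\<bar> powr p)" "b powr p = (\<Sum>i. \<bar>z i\<bar> powr p)"
        using assms lp_norm_powr[of x p] lp_norm_powr[of z p] by (auto simp: a_def b_def)
      then show ?thesis
        by (simp only:) (intro sums_unique[symmetric] sums_mult sums_add summable_sums sm)
    qed
    also have "\<dots> = (a + b) powr p" using pos uv by simp
    finally show ?thesis by (rule powr_le_imp_le_base) (use assms pos in auto)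
  qed
qed

lemma lp_lincomb:
  assumes "x \<in> lp p" "z \<in> lp p" "1 \<le> p"
  shows "(\<lambda>i. a * x i + b * z i) \<in> lp p"
  using assms by (intro lp_add lp_scale)

lemma lp_diff:
  assumes "x \<in> lp p" "z \<in> lp p" "1 \<le> p"
  shows "x - z \<in> lp p"
  using lp_lincomb[OF assms, of 1 "-1"] by (simp add: fun_diff_def)

lemma lp_norm_minus_commute: "lp_norm p (x - z) = lp_norm p (z - x)"
  by (simp add: lp_norm_def abs_minus_commute)

lemma lp_norm_triangle_sub:
  assumes "x \<in> lp p" "z \<in> lp p" "1 \<le> p"
  shows "lp_norm p x \<le> lp_norm p z + lp_norm p (x - z)"
  using lp_norm_triangle[OF assms(2) lp_diff[OF assms] assms(3)] by simp

lemma lp_norm_diff_le: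
  assumes "x \<in> lp p" "z \<in> lp p" "1 \<le> p"
  shows "lp_norm p (x - z) \<le> lp_norm p x + lp_norm p z"
  using lp_norm_triangle[OF assms(1) lp_scale[OF assms(2), of "-1"] assms(3)]
    lp_norm_scale[OF assms(2), of "-1"] assms(3)
  by (simp add: fun_diff_def)

subsection \<open>The duality map and the Bregman distance\<close>

text \<open>The weighted arithmetic-geometric mean inequality bounds
  \<open>v powr (p - 1) * u powr (2 - p)\<close>. Subtracting this from \<open>u\<close> gives the
  claim with base \<open>u\<close>, and enlarging the base to \<open>u + v\<close> preserves
  it.\<close>

lemma dualmap_scalar_monotone_same_sign:
  fixes u v p :: real
  assumes "1 < p" "p \<le> 2" "0 \<le> v" "v \<le> u"
  shows "(p - 1) * (u - v) \<le> (u powr (p - 1) - v powr (p - 1)) * (u + v) powr (2 - p)"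
proof (cases "u = 0")
  case True
  then show ?thesis using assms by auto
next
  case False
  then have "u > 0" using assms by auto
  have "v powr (p - 1) * u powr (2 - p) \<le> (p - 1) * v + (2 - p) * u"
    using assms by (intro Youngs_inequality_nonneg) auto
  moreover have "u powr (p - 1) * u powr (2 - p) = u"
    using \<open>u > 0\<close> by (simp flip: powr_add)
  ultimately have "(p - 1) * (u - v) \<le> (u powr (p - 1) - v powr (p - 1)) * u powr (2 - p)"
    by (simp add: algebra_simps)
  also have "\<dots> \<le> (u powr (p - 1) - v powr (p - 1)) * (u + v) powr (2 - p)"
    using assms by (intro mult_left_mono powr_mono2) (auto intro!: powr_mono2)
  finally show ?thesis .
qed

text \<open>On the unit interval \<open>t \<le> t powr e\<close>; this is applied to the shares of
  \<open>u\<close> and \<open>v\<close> in \<open>u + v\<close>, which add up to one.\<close>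

lemma powr_subadditive:
  fixes u v e :: real
  assumes "0 \<le> e" "e \<le> 1" "0 \<le> u" "0 \<le> v"
  shows "(u + v) powr e \<le> u powr e + v powr e"
proof (cases "u + v = 0")
  case False
  then have pos: "0 < u + v" using assms by simp
  have le: "a / (u + v) \<le> a powr e / (u + v) powr e" if "0 \<le> a" "a \<le> u + v" for a
    using powr_mono'[of e 1 "a / (u + v)"] that pos assms by (simp add: powr_divide)
  have "1 = u / (u + v) + v / (u + v)" using pos by (simp flip: add_divide_distrib)
  also have "\<dots> \<le> (u powr e + v powr e) / (u + v) powr e"
    using le[of u] le[of v] assms by (simp add: add_divide_distrib)
  finally show ?thesis using pos by (simp add: field_simps)
qed (use assms in auto)

lemma dualmap_scalar_monotone_opposite_sign:
  fixes u v p :: real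
  assumes "1 < p" "p \<le> 2" "0 \<le> u" "0 \<le> v"
  shows "(p - 1) * (u + v) \<le> (u powr (p - 1) + v powr (p - 1)) * (u + v) powr (2 - p)"
proof -
  have "(p - 1) * (u + v) \<le> u + v"
    using assms by (intro mult_left_le_one_le) auto
  also have "u + v = (u + v) powr (p - 1) * (u + v) powr (2 - p)"
    using assms by (cases "u + v = 0") (auto simp flip: powr_add)
  also have "\<dots> \<le> (u powr (p - 1) + v powr (p - 1)) * (u + v) powr (2 - p)"
    using assms by (intro mult_right_mono powr_subadditive) auto
  finally show ?thesis .
qed

text \<open>A weighted lower bound in multiplied-out form: the nonnegative exponent
  \<open>2 - p\<close> on the right avoids a singularity where both entries vanish.\<close>

lemma dualmap_scalar_monotone:
  fixes u v p :: real
  assumes p: "1 < p" "p \<le> 2"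
  shows "(p - 1) * (u - v)\<^sup>2
    \<le> ((\<bar>u\<bar> powr (p - 1) * sgn u - \<bar>v\<bar> powr (p - 1) * sgn v) * (u - v)) * (\<bar>u\<bar> + \<bar>v\<bar>) powr (2 - p)"
    (is "?P u v")
proof -
  have abs_step: "?P u v" if "v \<le> u" "0 \<le> u" for u v
  proof -
    have "(p - 1) * (u - v) \<le> (\<bar>u\<bar> powr (p - 1) * sgn u - \<bar>v\<bar> powr (p - 1) * sgn v)
        * (\<bar>u\<bar> + \<bar>v\<bar>) powr (2 - p)"
    proof (cases "0 \<le> v")
      case True
      then show ?thesis
        using dualmap_scalar_monotone_same_sign[OF p True that(1)] that
        by (auto simp: sgn_if)
    next
      case False
      then show ?thesis
        using dualmap_scalar_monotone_opposite_sign[OF p that(2), of "-v"] that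
        by (auto simp: sgn_if)
    qed
    from mult_right_mono[OF this, of "u - v"] that show ?thesis
      by (simp add: power2_eq_square mult_ac)
  qed
  \<comment> \<open>\<open>abs_step\<close> treats a larger first argument that is nonnegative.
    Swapping the arguments or negating both, under which the claim is invariant, reaches all other
    configurations.\<close>
  consider "v \<le> u" "0 \<le> u" | "u \<le> v" "0 \<le> v" | "u \<le> 0" "v \<le> u" | "v \<le> 0" "u \<le> v"
    by linarith
  then show ?thesis
  proof cases
    case 1
    then show ?thesis by (rule abs_step)
  next
    case 2
    from abs_step[OF this] show ?thesis
      by (simp add: power2_commute add.commute algebra_simps)
  next
    case 3
    from 3 have "?P (-v) (-u)" by (intro abs_step) auto
    then show ?thesis
      by (simp add: sgn_minus power2_commute add.commute algebra_simps)
  next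
    case 4
    from 4 have "?P (-u) (-v)" by (intro abs_step) auto
    then show ?thesis
      by (simp add: sgn_minus power2_commute add.commute algebra_simps)
  qed
qed

lemma power2_powr_half: "(t\<^sup>2) powr (p / 2) = \<bar>t\<bar> powr p" for t p :: real
proof -
  have "t\<^sup>2 = \<bar>t\<bar> powr 2" by (cases "t = 0") auto
  then show ?thesis by (simp only: powr_powr) simp
qed

text \<open>What is fixed here is symmetric in \<open>p\<close> and \<open>q\<close>, so through
  \<open>swapped\<close> each fact is also available for the dual space; \<open>p \<le> 2\<close> is
  assumed locally by the estimates that depend on it.\<close>

locale lp_exponents =
  fixes p q :: real
  assumes p_gt_1: "1 < p" and conjugate: "1 / p + 1 / q = 1"
begin

lemma q_gt_1: "1 < q"
proof -
  have "0 < 1 / p" "1 / p < 1" using p_gt_1 by auto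
  then have "0 < 1 / q" "1 / q < 1" using conjugate by linarith+
  then show ?thesis by (cases "0 < q") (auto simp: field_simps)
qed

lemma swapped: "lp_exponents q p"
  using q_gt_1 conjugate by unfold_locales (auto simp: add.commute)

lemma p_pos [simp]: "0 < p" and p_nonneg [simp]: "0 \<le> p" and p_ge_1 [simp]: "1 \<le> p"
  and q_pos [simp]: "0 < q" and q_nonneg [simp]: "0 \<le> q" and q_ge_1 [simp]: "1 \<le> q"
  and p_neq_0 [simp]: "p \<noteq> 0" and q_neq_0 [simp]: "q \<noteq> 0"
  using p_gt_1 q_gt_1 by auto

lemma p_mult_q: "p * q = p + q"
  using conjugate by (simp add: field_simps)

lemma pm1_mult_q [simp]: "(p - 1) * q = p" and qm1_mult_p [simp]: "(q - 1) * p = q"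
  and pm1_mult_qm1 [simp]: "(p - 1) * (q - 1) = 1"
  using p_mult_q by (auto simp: algebra_simps)

lemma
  assumes "\<xi> \<in> lp q" "x \<in> lp p"
  shows lp_pair_summable: "summable (\<lambda>i. \<xi> i * x i)"
    and lp_pair_bound: "\<bar>lp_pair \<xi> x\<bar> \<le> lp_norm q \<xi> * lp_norm p x"
proof -
  have sm: "summable (\<lambda>i. \<bar>\<xi> i\<bar> powr q)" "summable (\<lambda>i. \<bar>x i\<bar> powr p)"
    using assms by (auto simp: lp_def)
  have eq: "(\<bar>\<xi> i\<bar> powr q) powr (1/q) * (\<bar>x i\<bar> powr p) powr (1/p) = \<bar>\<xi> i * x i\<bar>" for i
    by (simp add: powr_powr abs_mult)
  have c: "1 / q + 1 / p = 1" using conjugate by simp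
  have S: "summable (\<lambda>i. \<bar>\<xi> i * x i\<bar>)"
    using summable_powr_mult[OF _ _ sm _ _ c] by (simp add: eq)
  then show "summable (\<lambda>i. \<xi> i * x i)" by (rule summable_rabs_cancel)
  have "\<bar>lp_pair \<xi> x\<bar> \<le> (\<Sum>i. \<bar>\<xi> i * x i\<bar>)"
    unfolding lp_pair_def by (rule summable_rabs[OF S])
  also have "\<dots> \<le> lp_norm q \<xi> * lp_norm p x"
    using suminf_powr_mult_le[OF _ _ sm _ _ c] by (simp add: eq lp_norm_def)
  finally show "\<bar>lp_pair \<xi> x\<bar> \<le> lp_norm q \<xi> * lp_norm p x" .
qed

lemma lp_pair_lincomb_right:
  assumes "\<xi> \<in> lp q" "x \<in> lp p" "z \<in> lp p"
  shows "lp_pair \<xi> (\<lambda>i. a * x i + b * z i) = a * lp_pair \<xi> x + b * lp_pair \<xi> z"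
proof -
  have "(\<lambda>i. \<xi> i * (a * x i + b * z i)) = (\<lambda>i. a * (\<xi> i * x i) + b * (\<xi> i * z i))"
    by (auto simp: algebra_simps)
  moreover have "\<dots> sums (a * lp_pair \<xi> x + b * lp_pair \<xi> z)"
    unfolding lp_pair_def
    by (intro sums_add sums_mult summable_sums lp_pair_summable assms)
  ultimately show ?thesis by (simp add: lp_pair_def sums_iff)
qed

lemma lp_pair_diff_right:
  assumes "\<xi> \<in> lp q" "x \<in> lp p" "z \<in> lp p"
  shows "lp_pair \<xi> (x - z) = lp_pair \<xi> x - lp_pair \<xi> z"
  using lp_pair_lincomb_right[OF assms, of 1 "-1"] by (simp add: fun_diff_def)

lemma lp_pair_scale_right:
  assumes "\<xi> \<in> lp q" "x \<in> lp p"
  shows "lp_pair \<xi> (\<lambda>i. a * x i) = a * lp_pair \<xi> x"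
  using lp_pair_lincomb_right[OF assms assms(2), of a 0] by simp

lemma lp_pair_commute: "lp_pair \<xi> x = lp_pair x \<xi>"
  by (simp add: lp_pair_def mult.commute)

lemma lp_pair_lincomb_left:
  assumes "\<xi> \<in> lp q" "\<eta> \<in> lp q" "x \<in> lp p"
  shows "lp_pair (\<lambda>i. a * \<xi> i + b * \<eta> i) x = a * lp_pair \<xi> x + b * lp_pair \<eta> x"
  using lp_exponents.lp_pair_lincomb_right[OF swapped assms(3,1,2)]
  by (simp add: lp_pair_commute)

lemma lp_pair_diff_left:
  assumes "\<xi> \<in> lp q" "\<eta> \<in> lp q" "x \<in> lp p"
  shows "lp_pair (\<xi> - \<eta>) x = lp_pair \<xi> x - lp_pair \<eta> x"
  using lp_pair_lincomb_left[OF assms, of 1 "-1"] by (simp add: fun_diff_def)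

lemma abs_dualmap [simp]: "\<bar>dualmap p x i\<bar> = \<bar>x i\<bar> powr (p - 1)"
  by (auto simp: dualmap_def abs_mult sgn_if)

lemma dualmap_in_lq [simp, intro]: "x \<in> lp p \<Longrightarrow> dualmap p x \<in> lp q"
  by (simp add: lp_def powr_powr)

lemma lp_norm_dualmap: "x \<in> lp p \<Longrightarrow> lp_norm q (dualmap p x) = lp_norm p x powr (p - 1)"
proof -
  have "(p - 1) / p = 1 / q"
    using pm1_mult_q by (simp add: field_simps)
  then show ?thesis
    by (simp add: lp_norm_def powr_powr)
qed

lemma dualmap_inverse [simp]: "dualmap q (dualmap p x) = x"
proof
  fix i
  have "dualmap q (dualmap p x) i = \<bar>dualmap p x i\<bar> powr (q - 1) * sgn (dualmap p x i)"
    by (simp add: dualmap_def)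
  also have "\<dots> = \<bar>x i\<bar> * sgn (x i)"
    by (cases "x i = 0") (simp_all add: powr_powr, simp_all add: dualmap_def sgn_mult)
  finally show "dualmap q (dualmap p x) i = x i" by (auto simp: sgn_if)
qed

lemma lp_pair_dualmap_self: "x \<in> lp p \<Longrightarrow> lp_pair (dualmap p x) x = lp_norm p x powr p"
proof -
  assume x: "x \<in> lp p"
  have "dualmap p x i * x i = \<bar>x i\<bar> powr p" for i
  proof (cases "x i = 0")
    case False
    have "dualmap p x i * x i = \<bar>x i\<bar> powr (p - 1) * \<bar>x i\<bar>"
      by (auto simp: dualmap_def sgn_if)
    also have "\<dots> = \<bar>x i\<bar> powr p"
      using False by (simp add: powr_mult_base powr_diff)
    finally show ?thesis .
  qed (simp add: dualmap_def)
  then show ?thesis using x by (simp add: lp_pair_def lp_norm_powr)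
qed

text \<open>The Fenchel-Young inequality for \<open>fp p\<close>: Hoelder on the pairing, then Young
  with exponent \<open>p\<close> on the norm of \<open>z\<close> and \<open>q\<close> on
  \<open>lp_norm p x powr (p - 1)\<close>.\<close>

lemma bregman_nonneg:
  assumes "x \<in> lp p" "z \<in> lp p"
  shows "0 \<le> bregman p z x"
proof -
  have "lp_pair (dualmap p x) z \<le> lp_norm p x powr (p - 1) * lp_norm p z"
    using lp_pair_bound[of "dualmap p x" z] assms by (simp add: lp_norm_dualmap)
  also have "\<dots> = lp_norm p z * lp_norm p x powr (p - 1)" by simp
  also have "\<dots> \<le> lp_norm p z powr p / p + (lp_norm p x powr (p - 1)) powr q / q"
    using p_gt_1 q_gt_1 conjugate by (intro Youngs_inequality) auto
  also have "\<dots> = lp_norm p z powr p / p + lp_norm p x powr p / q" by (simp add: powr_powr)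
  also have "lp_norm p x powr p / q = lp_norm p x powr p - lp_norm p x powr p / p"
  proof -
    have "1 / q = 1 - 1 / p" using conjugate by simp
    then have "lp_norm p x powr p * (1 / q) = lp_norm p x powr p * (1 - 1 / p)" by simp
    then show ?thesis by (simp add: algebra_simps)
  qed
  finally show ?thesis
    using assms by (simp add: bregman_def fp_def lp_pair_diff_right lp_pair_dualmap_self)
qed

text \<open>Used in two ways: for one dual step from \<open>x\<close> to \<open>x'\<close> seen from
  a fixed centre \<open>z\<close>, and for moving the centre from one minimizer to the next while
  the iterate stays.\<close>

lemma bregman_three_point:
  assumes "x \<in> lp p" "x' \<in> lp p" "z \<in> lp p"
  shows "bregman p z x' = bregman p z x + bregman p x x'
    + lp_pair (dualmap p x - dualmap p x') (z - x)"
  using assms by (simp add: bregman_def lp_pair_diff_right lp_pair_diff_left lp_diff)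

lemma bregman_symmetric_sum:
  assumes "x \<in> lp p" "z \<in> lp p"
  shows "bregman p x z + bregman p z x = lp_pair (dualmap p x - dualmap p z) (x - z)"
  using assms by (simp add: bregman_def lp_pair_diff_right lp_pair_diff_left lp_diff)

text \<open>Quantitative convexity of \<open>fp p\<close> on bounded sets. The scalar estimate,
  raised to the power \<open>p / 2\<close>, is summed by Hoelder with weights \<open>p / 2\<close>
  and \<open>(2 - p) / 2\<close>; the two resulting factors are the pairing and the norms.\<close>

lemma dualmap_monotone:
  assumes x: "x \<in> lp p" and z: "z \<in> lp p" and p2: "p \<le> 2"
  shows "(p - 1) * (lp_norm p (x - z))\<^sup>2
    \<le> lp_pair (dualmap p x - dualmap p z) (x - z) * (lp_norm p x + lp_norm p z) powr (2 - p)"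
proof -
  define w where "w i = (dualmap p x - dualmap p z) i * (x - z) i / (p - 1)" for i
  define m where "m i = \<bar>x i\<bar> + \<bar>z i\<bar>" for i
  define W where "W = lp_pair (dualmap p x - dualmap p z) (x - z) / (p - 1)"
  define N where "N = lp_norm p x + lp_norm p z"
  have scalar: "((x - z) i)\<^sup>2 \<le> w i * m i powr (2 - p)" for i
    using dualmap_scalar_monotone[OF p_gt_1 p2, of "x i" "z i"] p_gt_1
    by (simp add: w_def m_def dualmap_def field_simps)
  have m0: "0 \<le> m i" for i by (simp add: m_def)
  \<comment> \<open>The sign is read off from the scalar estimate where \<open>m i\<close> is
    positive; where it vanishes, both entries are zero.\<close>
  have w0: "0 \<le> w i" for i
  proof (cases "m i = 0")
    case True
    then have "x i = 0" by (simp add: m_def)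
    with True show ?thesis by (simp add: w_def m_def)
  next
    case False
    have "0 \<le> w i * m i powr (2 - p)" using scalar[of i] by (meson order_trans zero_le_power2)
    then show ?thesis using False by (simp add: zero_le_mult_iff m0)
  qed
  have d: "dualmap p x - dualmap p z \<in> lp q" "x - z \<in> lp p"
    using x z by (auto intro!: lp_diff)
  have wsums: "w sums W"
    unfolding w_def W_def lp_pair_def
    by (intro sums_divide summable_sums lp_pair_summable d)
  have absx: "(\<lambda>i. \<bar>y i\<bar>) \<in> lp p" "lp_norm p (\<lambda>i. \<bar>y i\<bar>) = lp_norm p y" if "y \<in> lp p" for y
    using that by (auto simp: lp_def lp_norm_def)
  have "m = (\<lambda>i. \<bar>x i\<bar> + \<bar>z i\<bar>)" by (simp add: fun_eq_iff m_def)
  then have m: "m \<in> lp p" "lp_norm p m \<le> N"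
    using lp_add[OF absx(1)[OF x] absx(1)[OF z] p_ge_1]
      lp_norm_triangle[OF absx(1)[OF x] absx(1)[OF z] p_ge_1]
    by (simp_all only: N_def absx(2)[OF x] absx(2)[OF z])
  have msum: "summable (\<lambda>i. m i powr p)" using m(1) m0 by (simp add: lp_def)
  have msuminf: "(\<Sum>i. m i powr p) = lp_norm p m powr p" using lp_norm_powr[OF m(1)] m0 by simp
  have e: "0 \<le> p / 2" "0 \<le> (2 - p) / 2" "p / 2 + (2 - p) / 2 = 1"
    using p2 by (auto simp: field_simps)
  have pt: "\<bar>(x - z) i\<bar> powr p \<le> w i powr (p / 2) * (m i powr p) powr ((2 - p) / 2)" for i
  proof -
    have "\<bar>(x - z) i\<bar> powr p = (((x - z) i)\<^sup>2) powr (p / 2)"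
      by (simp only: power2_powr_half)
    also have "\<dots> \<le> (w i * m i powr (2 - p)) powr (p / 2)"
      using scalar by (intro powr_mono2) auto
    also have "\<dots> = w i powr (p / 2) * (m i powr p) powr ((2 - p) / 2)"
      using w0 m0 by (simp add: powr_mult powr_powr mult.commute)
    finally show ?thesis .
  qed
  have "lp_norm p (x - z) powr p = (\<Sum>i. \<bar>(x - z) i\<bar> powr p)"
    using lp_norm_powr[OF d(2)] by simp
  also have "\<dots> \<le> (\<Sum>i. w i powr (p / 2) * (m i powr p) powr ((2 - p) / 2))"
    using d(2) e w0 wsums msum
    by (intro suminf_le pt summable_powr_mult) (auto simp: lp_def sums_iff)
  also have "\<dots> \<le> W powr (p / 2) * (lp_norm p m powr p) powr ((2 - p) / 2)"
    using suminf_powr_mult_le[of w "\<lambda>i. m i powr p", OF w0 _ _ msum e] wsums by (simp add: sums_iff msuminf)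
  also have "\<dots> \<le> W powr (p / 2) * (N powr p) powr ((2 - p) / 2)"
    using m(2) p2 by (intro mult_left_mono powr_mono2) auto
  also have "\<dots> = (W * N powr (2 - p)) powr (p / 2)"
  proof -
    have "0 \<le> W" using wsums w0 by (metis sums_le sums_zero)
    moreover have "0 \<le> N" by (simp add: N_def)
    ultimately show ?thesis by (simp add: powr_mult powr_powr mult.commute)
  qed
  finally have "((lp_norm p (x - z))\<^sup>2) powr (p / 2) \<le> (W * N powr (2 - p)) powr (p / 2)"
    by (simp add: power2_powr_half)
  then have "(lp_norm p (x - z))\<^sup>2 \<le> W * N powr (2 - p)"
  proof (rule powr_le_imp_le_base)
    have "0 \<le> W" using wsums w0 by (metis sums_le sums_zero)
    then show "0 \<le> W * N powr (2 - p)" by simp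
  qed auto
  then show ?thesis
    using p_gt_1 by (simp add: W_def N_def field_simps)
qed

end

subsection \<open>Functionals and adjoints\<close>

lemma lp_finite_support:
  assumes "finite N" "\<And>i. i \<notin> N \<Longrightarrow> x i = 0"
  shows "x \<in> lp p"
  using assms by (auto simp: lp_def intro!: summable_finite[of N])

lemma
  assumes "lp_bounded_linear p T"
  shows lp_bounded_linear_add_scale: "\<And>x z a b. x \<in> lp p \<Longrightarrow> z \<in> lp p \<Longrightarrow>
      T (\<lambda>i. a * x i + b * z i) = a *\<^sub>R T x + b *\<^sub>R T z"
    and lp_bounded_linear_zero: "T (\<lambda>_. 0) = 0"
    and lp_bounded_linear_scale: "\<And>x a. x \<in> lp p \<Longrightarrow> T (\<lambda>i. a * x i) = a *\<^sub>R T x"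
    and lp_bounded_linear_diff: "\<And>x z. x \<in> lp p \<Longrightarrow> z \<in> lp p \<Longrightarrow> T (x - z) = T x - T z"
proof -
  show lin: "T (\<lambda>i. a * x i + b * z i) = a *\<^sub>R T x + b *\<^sub>R T z"
    if "x \<in> lp p" "z \<in> lp p" for x z a b
    using assms that by (auto simp: lp_bounded_linear_def)
  show "T (\<lambda>_. 0) = 0" using lin[of "\<lambda>_. 0" "\<lambda>_. 0" 0 0] by simp
  show "T (\<lambda>i. a * x i) = a *\<^sub>R T x" if "x \<in> lp p" for x a
    using lin[OF that that, of a 0] by simp
  show "T (x - z) = T x - T z" if "x \<in> lp p" "z \<in> lp p" for x z
    using lin[OF that, of 1 "-1"] by (simp add: fun_diff_def)
qed

context lp_exponents
begin

lemma
  assumes "lp_bounded_linear p T"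
  shows lp_onorm_nonneg: "0 \<le> lp_onorm p T"
    and lp_onorm_bound: "h \<in> lp p \<Longrightarrow> norm (T h) \<le> lp_onorm p T * lp_norm p h"
proof -
  obtain B where B: "\<And>x. x \<in> lp p \<Longrightarrow> norm (T x) \<le> B * lp_norm p x"
    using assms unfolding lp_bounded_linear_def by blast
  have bdd: "bdd_above ((\<lambda>h. norm (T h)) ` {h \<in> lp p. lp_norm p h \<le> 1})"
  proof (rule bdd_aboveI2)
    fix h assume h: "h \<in> {h \<in> lp p. lp_norm p h \<le> 1}"
    have "norm (T h) \<le> B * lp_norm p h" using B h by auto
    also have "\<dots> \<le> \<bar>B\<bar> * 1" using h by (intro mult_mono) auto
    finally show "norm (T h) \<le> \<bar>B\<bar>" by simp
  qed
  have le: "norm (T h) \<le> lp_onorm p T" if "h \<in> lp p" "lp_norm p h \<le> 1" for h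
    unfolding lp_onorm_def using that by (intro cSUP_upper[OF _ bdd]) auto
  show "0 \<le> lp_onorm p T"
    using le[of "\<lambda>_. 0"] by (simp add: lp_bounded_linear_zero[OF assms])
  show "norm (T h) \<le> lp_onorm p T * lp_norm p h" if h: "h \<in> lp p"
  proof (cases "lp_norm p h = 0")
    case True
    then show ?thesis using B[OF h] by simp
  next
    case False
    then have pos: "0 < lp_norm p h" using lp_norm_nonneg[of p h] by linarith
    define a where "a = 1 / lp_norm p h"
    have "norm (T (\<lambda>i. a * h i)) \<le> lp_onorm p T"
    proof (intro le lp_scale h)
      show "lp_norm p (\<lambda>i. a * h i) \<le> 1"
        using lp_norm_scale[OF h p_pos, of a] pos by (simp add: a_def)
    qed
    then show ?thesis
      unfolding lp_bounded_linear_scale[OF assms h]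
      using pos by (simp add: a_def field_simps)
  qed
qed

lemma lp_onorm_le:
  assumes "0 \<le> B" "\<And>h. h \<in> lp p \<Longrightarrow> norm (T h) \<le> B * lp_norm p h"
  shows "lp_onorm p T \<le> B"
  unfolding lp_onorm_def
proof (rule cSUP_least)
  show "{h \<in> lp p. lp_norm p h \<le> 1} \<noteq> {}"
    using zero_in_lp[of p] lp_norm_zero[of p] by (metis (mono_tags) empty_iff mem_Collect_eq zero_le_one)
  fix h assume h: "h \<in> {h \<in> lp p. lp_norm p h \<le> 1}"
  then have "norm (T h) \<le> B * lp_norm p h" using assms(2) by blast
  also have "\<dots> \<le> B" using h assms(1) by (intro mult_left_le) auto
  finally show "norm (T h) \<le> B" .
qed

lemma lp_bounded_linear_diff_map:
  assumes S: "lp_bounded_linear p S" and T: "lp_bounded_linear p T"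
  shows "lp_bounded_linear p (\<lambda>h. S h - T h)"
  unfolding lp_bounded_linear_def
proof (intro conjI ballI allI)
  show "S (\<lambda>i. a * x i + b * z i) - T (\<lambda>i. a * x i + b * z i)
      = a *\<^sub>R (S x - T x) + b *\<^sub>R (S z - T z)" if "x \<in> lp p" "z \<in> lp p" for x z a b
    using that lp_bounded_linear_add_scale[OF S] lp_bounded_linear_add_scale[OF T]
    by (simp add: algebra_simps)
  have "norm (S h - T h) \<le> (lp_onorm p S + lp_onorm p T) * lp_norm p h" if "h \<in> lp p" for h
    using lp_onorm_bound[OF S that] lp_onorm_bound[OF T that] norm_triangle_ineq4[of "S h" "T h"]
    by (simp add: algebra_simps)
  then show "\<exists>B. \<forall>h\<in>lp p. norm (S h - T h) \<le> B * lp_norm p h" by blast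
qed

text \<open>The representing sequence is \<open>\<xi> i = w \<bullet> T (e i)\<close>. Testing with the truncations of
  \<open>dualmap q \<xi>\<close> bounds the partial sums of \<open>\<bar>\<xi> i\<bar> powr q\<close>.\<close>

lemma lp_functional_representation:
  assumes T: "lp_bounded_linear p T"
  obtains \<xi> where "\<xi> \<in> lp q" "\<And>h. h \<in> lp p \<Longrightarrow> lp_pair \<xi> h = w \<bullet> T h"
    "lp_norm q \<xi> \<le> norm w * lp_onorm p T"
proof -
  define e :: "nat \<Rightarrow> nat \<Rightarrow> real" where "e k = (\<lambda>i. if i = k then 1 else 0)" for k
  define tr :: "nat \<Rightarrow> (nat \<Rightarrow> real) \<Rightarrow> nat \<Rightarrow> real"
    where "tr n x = (\<lambda>i. if i < n then x i else 0)" for n x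
  define \<xi> where "\<xi> i = w \<bullet> T (e i)" for i
  define N where "N = norm w * lp_onorm p T"
  have N0: "0 \<le> N" by (simp add: N_def lp_onorm_nonneg[OF T])
  have e_lp: "e k \<in> lp p" for k
    by (rule lp_finite_support[of "{k}"]) (auto simp: e_def)
  have tr_lp: "tr n x \<in> lp p" for n x
    by (rule lp_finite_support[of "{..<n}"]) (auto simp: tr_def)
  have Nb: "\<bar>w \<bullet> T h\<bar> \<le> N * lp_norm p h" if "h \<in> lp p" for h
  proof -
    have "\<bar>w \<bullet> T h\<bar> \<le> norm w * norm (T h)" by (rule Cauchy_Schwarz_ineq2)
    also have "\<dots> \<le> norm w * (lp_onorm p T * lp_norm p h)"
      by (intro mult_left_mono lp_onorm_bound[OF T that]) auto
    finally show ?thesis by (simp add: N_def mult.assoc)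
  qed
  have T_tr: "w \<bullet> T (tr n x) = (\<Sum>i<n. \<xi> i * x i)" for n x
  proof (induction n)
    case 0
    then show ?case by (simp add: tr_def lp_bounded_linear_zero[OF T])
  next
    case (Suc n)
    have "tr (Suc n) x = (\<lambda>i. 1 * tr n x i + x n * e n i)"
      by (auto simp: tr_def e_def fun_eq_iff less_Suc_eq)
    then show ?case
      by (simp only: lp_bounded_linear_add_scale[OF T tr_lp e_lp])
         (simp add: Suc inner_add_right \<xi>_def)
  qed
  have partial: "(\<Sum>i<n. \<bar>\<xi> i\<bar> powr q) \<le> N powr q" for n
  proof -
    define s where "s = (\<Sum>i<n. \<bar>\<xi> i\<bar> powr q)"
    have s0: "0 \<le> s" by (auto simp: s_def intro: sum_nonneg)
    define x where "x = dualmap q \<xi>"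
    have xabs: "\<bar>x i\<bar> powr p = \<bar>\<xi> i\<bar> powr q" for i
      using lp_exponents.abs_dualmap[OF swapped, of \<xi> i] by (simp add: x_def powr_powr)
    have "(\<Sum>i. \<bar>tr n x i\<bar> powr p) = s"
      by (subst suminf_finite[of "{..<n}"]) (auto simp: tr_def s_def xabs)
    then have norm_tr: "lp_norm p (tr n x) = s powr (1/p)" by (simp add: lp_norm_def)
    have "\<xi> i * x i = \<bar>\<xi> i\<bar> powr q" for i
    proof (cases "\<xi> i = 0")
      case False
      have "\<xi> i * x i = \<bar>\<xi> i\<bar> * \<bar>\<xi> i\<bar> powr (q - 1)"
        by (auto simp: x_def dualmap_def sgn_if)
      then show ?thesis using False by (simp add: powr_mult_base)
    qed (simp add: x_def dualmap_def)
    then have "w \<bullet> T (tr n x) = s" by (simp add: T_tr s_def)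
    \<comment> \<open>On the test sequence the functional equals \<open>s\<close> while the norm is
      \<open>s powr (1/p)\<close>. Cancelling leaves \<open>s powr (1/q)\<close>, the norm of the
      truncated \<open>\<xi>\<close>, below \<open>N\<close>.\<close>
    then have "s \<le> N * s powr (1/p)"
      using Nb[OF tr_lp, of n x] norm_tr by simp
    also have "1/p = 1 - 1/q" using conjugate by simp
    finally have *: "s \<le> N * s powr (1 - 1/q)" .
    have "s powr (1/q) \<le> N"
    proof (cases "s = 0")
      case False
      then have "0 < s" using s0 by simp
      have "s powr (1/q) * s powr (1 - 1/q) = s powr (1/q + (1 - 1/q))"
        by (rule powr_add[symmetric])
      also have "\<dots> = s" using \<open>0 < s\<close> by simp
      finally have "s powr (1/q) * s powr (1 - 1/q) \<le> N * s powr (1 - 1/q)"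
        using * by simp
      then show ?thesis using \<open>0 < s\<close> by simp
    qed (simp add: N0)
    then have "(s powr (1/q)) powr q \<le> N powr q" by (intro powr_mono2) auto
    then show ?thesis using s0 by (simp add: powr_powr flip: s_def)
  qed
  have sm: "summable (\<lambda>i. \<bar>\<xi> i\<bar> powr q)"
    by (rule summableI_nonneg_bounded[OF _ partial]) auto
  then have \<xi>: "\<xi> \<in> lp q" by (simp add: lp_def)
  have "lp_norm q \<xi> powr q \<le> N powr q"
    using suminf_le_const[OF sm partial] lp_norm_powr[OF \<xi>] by simp
  then have norm_le: "lp_norm q \<xi> \<le> N" by (rule powr_le_imp_le_base) (auto simp: N0)
  have "lp_pair \<xi> h = w \<bullet> T h" if h: "h \<in> lp p" for h
  proof -
    \<comment> \<open>Truncations converge in norm because the error is a tail of a convergent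
      series; boundedness of the functional then carries the identity from finitely supported
      sequences to \<open>h\<close>.\<close>
    have tail: "lp_norm p (h - tr n h) = ((\<Sum>i. \<bar>h i\<bar> powr p) - (\<Sum>i<n. \<bar>h i\<bar> powr p)) powr (1/p)" for n
    proof -
      have "(\<lambda>i. \<bar>(h - tr n h) i\<bar> powr p) = (\<lambda>i. \<bar>h i\<bar> powr p - (if i \<in> {..<n} then \<bar>h i\<bar> powr p else 0))"
        by (auto simp: tr_def)
      moreover have "\<dots> sums ((\<Sum>i. \<bar>h i\<bar> powr p) - (\<Sum>i<n. \<bar>h i\<bar> powr p))"
        using h by (intro sums_diff summable_sums sums_If_finite_set) (auto simp: lp_def)
      ultimately show ?thesis by (simp add: lp_norm_def sums_iff)
    qed
    have "(\<lambda>n. (\<Sum>i. \<bar>h i\<bar> powr p) - (\<Sum>i<n. \<bar>h i\<bar> powr p)) \<longlonglongrightarrow> 0"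
    proof -
      have "summable (\<lambda>i. \<bar>h i\<bar> powr p)" using h by (simp add: lp_def)
      from tendsto_diff[OF tendsto_const[of "\<Sum>i. \<bar>h i\<bar> powr p"] summable_LIMSEQ[OF this]]
      show ?thesis by simp
    qed
    then have "(\<lambda>n. lp_norm p (h - tr n h)) \<longlonglongrightarrow> 0"
      unfolding tail using h
      by (intro tendsto_zero_powrI[where b = "1/p"])
        (auto simp: lp_def intro!: always_eventually sum_le_suminf)
    then have "(\<lambda>n. N * lp_norm p (h - tr n h)) \<longlonglongrightarrow> 0"
      by (rule tendsto_mult_right_zero)
    then have "(\<lambda>n. w \<bullet> T (h - tr n h)) \<longlonglongrightarrow> 0"
      by (rule Lim_null_comparison[rotated])
         (use Nb lp_diff[OF h tr_lp] in \<open>auto intro!: eventuallyI\<close>)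
    then have "(\<lambda>n. w \<bullet> T h - (\<Sum>i<n. \<xi> i * h i)) \<longlonglongrightarrow> 0"
      by (simp add: lp_bounded_linear_diff[OF T h tr_lp] inner_diff_right T_tr)
    moreover have "(\<lambda>n. w \<bullet> T h - (\<Sum>i<n. \<xi> i * h i)) \<longlonglongrightarrow> w \<bullet> T h - lp_pair \<xi> h"
      unfolding lp_pair_def
      by (intro tendsto_diff tendsto_const summable_LIMSEQ lp_pair_summable[OF \<xi> h])
    ultimately show ?thesis using LIMSEQ_unique by fastforce
  qed
  then show ?thesis using that[OF \<xi>] norm_le by (auto simp: N_def)
qed

text \<open>The description in \<open>lp_adjoint\<close> denotes: the representation gives
  existence, and testing with unit sequences gives uniqueness.\<close>

lemma
  assumes T: "lp_bounded_linear p T"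
  shows lp_adjoint_in_lq: "lp_adjoint p q T w \<in> lp q"
    and lp_pair_adjoint: "h \<in> lp p \<Longrightarrow> lp_pair (lp_adjoint p q T w) h = w \<bullet> T h"
    and lp_norm_adjoint: "lp_norm q (lp_adjoint p q T w) \<le> norm w * lp_onorm p T"
proof -
  obtain \<xi> where \<xi>: "\<xi> \<in> lp q" "\<And>h. h \<in> lp p \<Longrightarrow> lp_pair \<xi> h = w \<bullet> T h"
    "lp_norm q \<xi> \<le> norm w * lp_onorm p T"
    using lp_functional_representation[OF T] by metis
  have "lp_adjoint p q T w = \<xi>"
    unfolding lp_adjoint_def
  proof (rule the_equality)
    fix \<eta> assume \<eta>: "\<eta> \<in> lp q \<and> (\<forall>h\<in>lp p. lp_pair \<eta> h = w \<bullet> T h)"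
    show "\<eta> = \<xi>"
    proof
      fix k
      define e :: "nat \<Rightarrow> real" where "e = (\<lambda>i. if i = k then 1 else 0)"
      have e: "e \<in> lp p" by (rule lp_finite_support[of "{k}"]) (auto simp: e_def)
      have "lp_pair \<zeta> e = \<zeta> k" for \<zeta>
        unfolding lp_pair_def by (subst suminf_finite[of "{k}"]) (auto simp: e_def)
      then show "\<eta> k = \<xi> k" using \<xi>(2)[OF e] \<eta> e by metis
    qed
  qed (use \<xi> in auto)
  with \<xi> show "lp_adjoint p q T w \<in> lp q"
    and "h \<in> lp p \<Longrightarrow> lp_pair (lp_adjoint p q T w) h = w \<bullet> T h"
    and "lp_norm q (lp_adjoint p q T w) \<le> norm w * lp_onorm p T" by auto
qed

end

subsection \<open>Tikhonov minimizers under the source condition\<close>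

text \<open>\<open>xa\<close> selects one global minimizer per parameter, since minimizers may fail
  to be unique. The exact datum appears as \<open>F xdag\<close>.\<close>

locale tikhonov_source_condition = lp_exponents p q for p q :: real +
  fixes F :: "(nat \<Rightarrow> real) \<Rightarrow> 'y::real_inner"
    and F' :: "(nat \<Rightarrow> real) \<Rightarrow> (nat \<Rightarrow> real) \<Rightarrow> 'y"
    and yd \<omega> :: 'y and xdag :: "nat \<Rightarrow> real" and xa :: "real \<Rightarrow> nat \<Rightarrow> real"
    and \<delta> ct L c s varrho \<alpha>s A K \<gamma> :: real
  assumes p_le_2: "p \<le> 2"
    and \<delta>_pos: "0 < \<delta>" and data_error: "norm (F xdag - yd) \<le> \<delta>"
    and ct_pos: "0 < ct"
    and bregman_le: "\<And>x z. x \<in> lp p \<Longrightarrow> z \<in> lp p \<Longrightarrow> bregman p z x \<le> ct * lp_norm p (x - z) powr p"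
    and deriv: "\<And>x. x \<in> lp p \<Longrightarrow> lp_has_derivative p F (F' x) x"
    and L_pos: "0 < L"
    and lipschitz: "\<And>x z. x \<in> lp p \<Longrightarrow> z \<in> lp p \<Longrightarrow>
      lp_onorm p (\<lambda>h. F' x h - F' z h) \<le> L * lp_norm p (x - z)"
    and c_pos: "0 < c"
    and nonlinearity: "\<And>x z. x \<in> lp p \<Longrightarrow> z \<in> lp p \<Longrightarrow>
      norm (F x - F z - F' z (x - z)) \<le> c * bregman p x z"
    and s_gt_2: "2 < s" and varrho_pos: "0 < varrho" and scr: "s * c * varrho < 1"
    and xdag: "xdag \<in> lp p"
    and \<omega>: "norm \<omega> \<le> varrho" "dualmap p xdag = lp_adjoint p q (F' xdag) \<omega>"
    and minimizer: "\<And>\<alpha>. 0 < \<alpha> \<Longrightarrow> tikhonov_minimizer p F yd \<alpha> (xa \<alpha>)"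
    and \<alpha>s_eq: "\<alpha>s = \<delta> / ((s - 2) * varrho)"
    and A_eq: "A = (p / (2 * \<alpha>s)) powr (1 / p) * norm (F (\<lambda>_. 0) - yd) powr (2 / p)"
    and K_eq: "K = L * A + lp_onorm p (F' (\<lambda>_. 0))"
    and \<gamma>_eq: "\<gamma> = (1 - s * c * varrho) / 2"
begin

abbreviation \<Phi> :: "real \<Rightarrow> (nat \<Rightarrow> real) \<Rightarrow> real" where "\<Phi> \<equiv> tikhonov p F yd"
abbreviation grad :: "real \<Rightarrow> (nat \<Rightarrow> real) \<Rightarrow> nat \<Rightarrow> real" where
  "grad \<equiv> tikhonov_grad p q F F' yd"

lemma \<alpha>s_pos: "0 < \<alpha>s"
  using \<delta>_pos s_gt_2 varrho_pos by (simp add: \<alpha>s_eq)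

lemma \<gamma>_pos: "0 < \<gamma>"
  using scr by (simp add: \<gamma>_eq)

lemma A_nonneg: "0 \<le> A"
  by (simp add: A_eq)

lemma F'_bounded_linear: "x \<in> lp p \<Longrightarrow> lp_bounded_linear p (F' x)"
  using deriv by (simp add: lp_has_derivative_def)

lemma K_nonneg: "0 \<le> K"
  using L_pos A_nonneg lp_onorm_nonneg[OF F'_bounded_linear[OF zero_in_lp]] by (simp add: K_eq)

lemma tikhonov_eq: "\<Phi> \<alpha> x = (norm (F x - yd))\<^sup>2 / 2 + \<alpha> * fp p x"
  by (simp add: tikhonov_def fp_def)

lemma fp_nonneg: "0 \<le> fp p x"
  by (simp add: fp_def)

lemma xa_in_lp: "0 < \<alpha> \<Longrightarrow> xa \<alpha> \<in> lp p"
  using minimizer by (simp add: tikhonov_minimizer_def)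

lemma xa_minimizes: "0 < \<alpha> \<Longrightarrow> z \<in> lp p \<Longrightarrow> \<Phi> \<alpha> (xa \<alpha>) \<le> \<Phi> \<alpha> z"
  using minimizer by (simp add: tikhonov_minimizer_def)

text \<open>Comparison with the zero sequence: the penalty at a minimizer is at most half the
  squared misfit at zero. Solving for the norm at the smallest parameter \<open>\<alpha>s\<close> is
  the origin of \<open>A\<close>.\<close>

lemma xa_norm_le:
  assumes "\<alpha>s \<le> \<alpha>"
  shows "lp_norm p (xa \<alpha>) \<le> A"
proof (rule powr_le_imp_le_base[of _ p])
  define n where "n = norm (F (\<lambda>_. 0) - yd)"
  have \<alpha>: "0 < \<alpha>" using \<alpha>s_pos assms by simp
  have "\<alpha> / p * lp_norm p (xa \<alpha>) powr p \<le> \<Phi> \<alpha> (xa \<alpha>)"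
    by (simp add: tikhonov_def)
  also have "\<dots> \<le> \<Phi> \<alpha> (\<lambda>_. 0)" by (rule xa_minimizes[OF \<alpha> zero_in_lp])
  also have "\<dots> = n\<^sup>2 / 2" by (simp add: tikhonov_def n_def)
  finally have "lp_norm p (xa \<alpha>) powr p \<le> p / (2 * \<alpha>) * n\<^sup>2"
    using \<alpha> by (simp add: field_simps)
  also have "\<dots> \<le> p / (2 * \<alpha>s) * n\<^sup>2"
    using \<alpha>s_pos assms by (intro mult_right_mono divide_left_mono) auto
  also have "\<dots> = A powr p"
  proof -
    have "(n powr (2 / p)) powr p = n\<^sup>2"
      by (cases "n = 0") (simp_all add: powr_powr n_def)
    then show ?thesis
      using \<alpha>s_pos by (simp add: A_eq powr_mult powr_powr n_def)
  qed
  finally show "lp_norm p (xa \<alpha>) powr p \<le> A powr p" .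
qed (simp_all add: A_nonneg)

text \<open>Comparison with \<open>xdag\<close>: the source condition turns the linear part of the
  penalty difference into a product of \<open>\<omega>\<close> with a value of
  \<open>F' xdag\<close>, which the nonlinearity bound expresses through residual, noise and Bregman
  distance. A quadratic inequality for the residual remains.\<close>

lemma residual_le:
  assumes "\<alpha>s \<le> \<alpha>"
  shows "norm (F (xa \<alpha>) - yd) \<le> s * varrho * \<alpha>"
proof -
  define R where "R = norm (F (xa \<alpha>) - yd)"
  define D where "D = bregman p (xa \<alpha>) xdag"
  have \<alpha>: "0 < \<alpha>" using \<alpha>s_pos assms by simp
  note xl = xa_in_lp[OF \<alpha>]
  have D0: "0 \<le> D" unfolding D_def by (rule bregman_nonneg[OF xdag xl])
  have pair: "lp_pair (dualmap p xdag) (xa \<alpha> - xdag) = \<omega> \<bullet> F' xdag (xa \<alpha> - xdag)"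
    unfolding \<omega>(2) by (intro lp_pair_adjoint F'_bounded_linear xdag lp_diff xl p_ge_1)
  have "norm (F' xdag (xa \<alpha> - xdag)) \<le> R + \<delta> + c * D"
  proof -
    have "F' xdag (xa \<alpha> - xdag) = (F (xa \<alpha>) - yd) - (F xdag - yd)
        - (F (xa \<alpha>) - F xdag - F' xdag (xa \<alpha> - xdag))" by simp
    then have "norm (F' xdag (xa \<alpha> - xdag)) \<le> norm (F (xa \<alpha>) - yd) + norm (F xdag - yd)
        + norm (F (xa \<alpha>) - F xdag - F' xdag (xa \<alpha> - xdag))"
      by (smt (verit) norm_triangle_ineq4)
    then show ?thesis
      using data_error nonlinearity[OF xl xdag] by (simp add: R_def D_def)
  qed
  then have "norm \<omega> * norm (F' xdag (xa \<alpha> - xdag)) \<le> varrho * (R + \<delta> + c * D)"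
    using \<omega>(1) varrho_pos by (intro mult_mono) auto
  then have pair_ge: "- (varrho * (R + \<delta> + c * D)) \<le> lp_pair (dualmap p xdag) (xa \<alpha> - xdag)"
    unfolding pair using Cauchy_Schwarz_ineq2[of \<omega> "F' xdag (xa \<alpha> - xdag)"] by linarith
  have "R\<^sup>2 / 2 + \<alpha> * fp p (xa \<alpha>) \<le> (norm (F xdag - yd))\<^sup>2 / 2 + \<alpha> * fp p xdag"
    using xa_minimizes[OF \<alpha> xdag] by (simp add: tikhonov_eq R_def)
  also have "\<dots> \<le> \<delta>\<^sup>2 / 2 + \<alpha> * fp p xdag"
    using data_error by (simp add: power_mono)
  finally have "R\<^sup>2 / 2 + \<alpha> * (fp p (xa \<alpha>) - fp p xdag) \<le> \<delta>\<^sup>2 / 2" by (simp add: algebra_simps)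
  moreover have "fp p (xa \<alpha>) - fp p xdag = D + lp_pair (dualmap p xdag) (xa \<alpha> - xdag)"
    by (simp add: D_def bregman_def)
  moreover have "\<alpha> * (D - varrho * (R + \<delta> + c * D))
      \<le> \<alpha> * (D + lp_pair (dualmap p xdag) (xa \<alpha> - xdag))"
    using pair_ge \<alpha> by (intro mult_left_mono) auto
  moreover have "0 \<le> \<alpha> * (D * (1 - c * varrho))"
  proof -
    have "1 * (c * varrho) \<le> s * (c * varrho)"
      using s_gt_2 c_pos varrho_pos by (intro mult_right_mono) auto
    then show ?thesis using \<alpha> D0 scr by (simp add: mult.assoc)
  qed
  ultimately have "R\<^sup>2 - 2 * \<alpha> * varrho * R \<le> \<delta>\<^sup>2 + 2 * \<alpha> * varrho * \<delta>"
    by (simp add: algebra_simps)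
  \<comment> \<open>Completing the square gives
    \<open>R \<le> \<delta> + 2 * \<alpha> * varrho\<close>; by the choice of
    \<open>\<alpha>s\<close> the term \<delta> is absorbed into the factor \<open>s\<close>.\<close>
  then have "(R - \<alpha> * varrho)\<^sup>2 \<le> (\<delta> + \<alpha> * varrho)\<^sup>2"
    by (simp add: power2_eq_square algebra_simps)
  then have "R - \<alpha> * varrho \<le> \<delta> + \<alpha> * varrho"
    by (rule power2_le_imp_le) (use \<delta>_pos \<alpha> varrho_pos in auto)
  moreover have "\<delta> \<le> \<alpha> * ((s - 2) * varrho)"
    using assms s_gt_2 varrho_pos by (simp add: \<alpha>s_eq field_simps)
  ultimately show ?thesis by (simp add: R_def algebra_simps)
qed

text \<open>\<open>K\<close> bounds the derivative on the ball of radius \<open>A\<close>, by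
  comparison with the derivative at zero. \<open>\<tau>\<close> is the allowed excess over
  \<open>A\<close>: \<open>0\<close> for minimizers, \<open>r\<close> near them.\<close>

lemma F'_norm_le:
  assumes x: "x \<in> lp p" and h: "h \<in> lp p" and "lp_norm p x \<le> A + \<tau>"
  shows "norm (F' x h) \<le> (K + L * \<tau>) * lp_norm p h"
proof -
  note bl = F'_bounded_linear
  have x0: "x - (\<lambda>_. 0) = x" by (simp add: fun_eq_iff)
  have "norm (F' x h - F' (\<lambda>_. 0) h) \<le> lp_onorm p (\<lambda>h. F' x h - F' (\<lambda>_. 0) h) * lp_norm p h"
    using lp_onorm_bound[OF lp_bounded_linear_diff_map[OF bl[OF x] bl[OF zero_in_lp]] h] .
  also have "\<dots> \<le> (L * lp_norm p x) * lp_norm p h"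
    using lipschitz[OF x zero_in_lp] by (intro mult_right_mono) (auto simp: x0)
  finally have "norm (F' x h - F' (\<lambda>_. 0) h) \<le> (L * lp_norm p x) * lp_norm p h" .
  moreover have "norm (F' (\<lambda>_. 0) h) \<le> lp_onorm p (F' (\<lambda>_. 0)) * lp_norm p h"
    by (rule lp_onorm_bound[OF bl[OF zero_in_lp] h])
  moreover have "norm (F' x h) \<le> norm (F' x h - F' (\<lambda>_. 0) h) + norm (F' (\<lambda>_. 0) h)"
    using norm_triangle_ineq[of "F' x h - F' (\<lambda>_. 0) h" "F' (\<lambda>_. 0) h"] by simp
  ultimately have "norm (F' x h) \<le> (L * lp_norm p x + lp_onorm p (F' (\<lambda>_. 0))) * lp_norm p h"
    by (simp add: distrib_right)
  also have "\<dots> \<le> (K + L * \<tau>) * lp_norm p h"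
  proof (rule mult_right_mono)
    have "L * lp_norm p x \<le> L * (A + \<tau>)" using L_pos assms(3) by (intro mult_left_mono) auto
    then show "L * lp_norm p x + lp_onorm p (F' (\<lambda>_. 0)) \<le> K + L * \<tau>"
      by (simp add: K_eq algebra_simps)
  qed simp
  finally show ?thesis .
qed

lemma lp_norm_near_xa:
  assumes "x \<in> lp p" "\<alpha>s \<le> \<alpha>" "lp_norm p (x - xa \<alpha>) \<le> \<tau>"
  shows "lp_norm p x \<le> A + \<tau>"
proof -
  have "xa \<alpha> \<in> lp p" using xa_in_lp \<alpha>s_pos assms by simp
  then show ?thesis
    using lp_norm_triangle_sub[of x p "xa \<alpha>"] xa_norm_le[of \<alpha>] assms by simp
qed

lemma grad_in_lq:
  assumes "x \<in> lp p"
  shows "grad \<alpha> x \<in> lp q"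
proof -
  have "(\<lambda>i. 1 * lp_adjoint p q (F' x) (F x - yd) i + \<alpha> * dualmap p x i) \<in> lp q"
    using assms by (intro lp_lincomb lp_adjoint_in_lq F'_bounded_linear) auto
  then show ?thesis by (simp add: tikhonov_grad_def[abs_def])
qed

lemma lp_pair_grad:
  assumes "x \<in> lp p" "h \<in> lp p"
  shows "lp_pair (grad \<alpha> x) h = (F x - yd) \<bullet> F' x h + \<alpha> * lp_pair (dualmap p x) h"
proof -
  have "lp_pair (\<lambda>i. 1 * lp_adjoint p q (F' x) (F x - yd) i + \<alpha> * dualmap p x i) h
      = 1 * lp_pair (lp_adjoint p q (F' x) (F x - yd)) h + \<alpha> * lp_pair (dualmap p x) h"
    using assms by (intro lp_pair_lincomb_left lp_adjoint_in_lq F'_bounded_linear) auto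
  then show ?thesis
    using lp_pair_adjoint[OF F'_bounded_linear[OF assms(1)] assms(2), of "F x - yd"]
    by (simp add: tikhonov_grad_def[abs_def])
qed

text \<open>An exact identity. The linearisation error of \<open>F\<close> meets only the residual
  at \<open>z\<close>, so a small residual lets the Bregman term absorb it.\<close>

lemma tikhonov_expansion:
  assumes "x \<in> lp p" "z \<in> lp p"
  shows "\<Phi> \<alpha> x - \<Phi> \<alpha> z = (norm (F x - F z))\<^sup>2 / 2 + lp_pair (grad \<alpha> z) (x - z)
    + (F z - yd) \<bullet> (F x - F z - F' z (x - z)) + \<alpha> * bregman p x z"
proof -
  have "(norm (F x - yd))\<^sup>2 = (norm (F z - yd))\<^sup>2 + 2 * ((F z - yd) \<bullet> (F x - F z))
      + (norm (F x - F z))\<^sup>2"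
    by (simp add: power2_norm_eq_inner inner_diff_left inner_diff_right inner_commute)
  then show ?thesis
    using assms by (simp add: tikhonov_eq lp_pair_grad lp_diff bregman_def inner_diff_right algebra_simps)
qed

text \<open>Both remainders in the expansion of the functional are \<open>O(t powr p)\<close> along a line, so
  no differentiability of the norm is needed.\<close>

lemma stationary:
  assumes \<alpha>: "0 < \<alpha>" and h: "h \<in> lp p"
  shows "lp_pair (grad \<alpha> (xa \<alpha>)) h = 0"
proof -
  define z where "z = xa \<alpha>"
  have z: "z \<in> lp p" unfolding z_def by (rule xa_in_lp[OF \<alpha>])
  have nonneg: "0 \<le> lp_pair (grad \<alpha> z) h" if h: "h \<in> lp p" for h
  proof -
    define H where "H = lp_norm p h powr p"
    define B where "B = norm (F' z h) + c * ct * H"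
    define E where "E = norm (F z - yd) * (c * ct * H) + \<alpha> * (ct * H)"
    have H0: "0 \<le> H" by (simp add: H_def)
    have ineq: "0 \<le> t * B\<^sup>2 / 2 + lp_pair (grad \<alpha> z) h + t powr (p - 1) * E"
      if t: "0 < t" "t < 1" for t
    proof -
      define x where "x = (\<lambda>i. 1 * z i + t * h i)"
      have x: "x \<in> lp p" unfolding x_def by (intro lp_lincomb z h) auto
      have xz: "x - z = (\<lambda>i. t * h i)" by (simp add: x_def fun_diff_def)
      have tp: "t powr p = t * t powr (p - 1)" using t by (simp add: powr_mult_base)
      have tp_le: "t powr (p - 1) \<le> 1" using t p_gt_1 by (intro powr_le1) auto
      have D: "bregman p x z \<le> ct * (t powr p * H)"
        using bregman_le[OF z x] t
        by (simp add: lp_norm_minus_commute[of p z] xz lp_norm_scale[OF h] powr_mult H_def)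
      have e: "norm (F x - F z - t *\<^sub>R F' z h) \<le> c * ct * H * t powr p"
      proof -
        have "norm (F x - F z - t *\<^sub>R F' z h) \<le> c * bregman p x z"
          using nonlinearity[OF x z]
          by (simp add: xz lp_bounded_linear_scale[OF F'_bounded_linear[OF z] h])
        also have "\<dots> \<le> c * (ct * (t powr p * H))"
          using c_pos by (intro mult_left_mono D) auto
        finally show ?thesis by (simp add: mult_ac)
      qed
      have "norm (F x - F z) \<le> norm (t *\<^sub>R F' z h) + norm (F x - F z - t *\<^sub>R F' z h)"
        using norm_triangle_ineq[of "t *\<^sub>R F' z h" "F x - F z - t *\<^sub>R F' z h"] by simp
      also have "\<dots> \<le> t * norm (F' z h) + c * ct * H * t powr p" using e t by simp
      also have "\<dots> \<le> t * B"
      proof -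
        have "c * ct * H * t powr (p - 1) \<le> c * ct * H"
          using tp_le H0 c_pos ct_pos by (intro mult_left_le) auto
        then have "t * (c * ct * H * t powr (p - 1)) \<le> t * (c * ct * H)"
          using t by (intro mult_left_mono) auto
        then show ?thesis by (simp add: B_def tp algebra_simps)
      qed
      finally have v: "(norm (F x - F z))\<^sup>2 \<le> (t * B)\<^sup>2" by (intro power_mono) auto
      have u: "(F z - yd) \<bullet> (F x - F z - F' z (x - z)) \<le> norm (F z - yd) * (c * ct * H * t powr p)"
      proof -
        have "(F z - yd) \<bullet> (F x - F z - t *\<^sub>R F' z h) \<le> norm (F z - yd) * norm (F x - F z - t *\<^sub>R F' z h)"
          by (rule norm_cauchy_schwarz)
        also have "\<dots> \<le> norm (F z - yd) * (c * ct * H * t powr p)"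
          by (intro mult_left_mono e) auto
        finally show ?thesis
          by (simp add: xz lp_bounded_linear_scale[OF F'_bounded_linear[OF z] h])
      qed
      have "0 \<le> \<Phi> \<alpha> x - \<Phi> \<alpha> z" using xa_minimizes[OF \<alpha> x] by (simp add: z_def)
      also have "\<dots> \<le> (t * B)\<^sup>2 / 2 + t * lp_pair (grad \<alpha> z) h
          + norm (F z - yd) * (c * ct * H * t powr p) + \<alpha> * (ct * (t powr p * H))"
      proof -
        have "\<alpha> * bregman p x z \<le> \<alpha> * (ct * (t powr p * H))"
          using \<alpha> by (intro mult_left_mono D) auto
        moreover have "lp_pair (grad \<alpha> z) (x - z) = t * lp_pair (grad \<alpha> z) h"
          unfolding xz by (rule lp_pair_scale_right[OF grad_in_lq[OF z] h])
        ultimately show ?thesis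
          unfolding tikhonov_expansion[OF x z] using v u by linarith
      qed
      \<comment> \<open>Each term carries a factor \<open>t\<close>; after division the nonlinear
        ones still vanish as \<open>t\<close> tends to \<open>0\<close>, because
        \<open>p - 1 > 0\<close>.\<close>
      also have "\<dots> = t * (t * B\<^sup>2 / 2 + lp_pair (grad \<alpha> z) h + t powr (p - 1) * E)"
        by (simp add: tp E_def power2_eq_square algebra_simps)
      finally show ?thesis using t by (simp add: zero_le_mult_iff)
    qed
    have "((\<lambda>t. t * B\<^sup>2 / 2 + lp_pair (grad \<alpha> z) h + t powr (p - 1) * E)
        \<longlongrightarrow> 0 * B\<^sup>2 / 2 + lp_pair (grad \<alpha> z) h + 0 * E) (at_right 0)"
    proof (intro tendsto_intros tendsto_zero_powrI)
      show "eventually (\<lambda>t::real. 0 \<le> t) (at_right 0)"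
        by (auto simp: eventually_at_filter)
    qed (use p_gt_1 in auto)
    moreover have "eventually (\<lambda>t. 0 \<le> t * B\<^sup>2 / 2 + lp_pair (grad \<alpha> z) h + t powr (p - 1) * E) (at_right 0)"
      using eventually_at_right_real[of 0 1] by (rule eventually_mono) (auto intro!: ineq)
    ultimately have "0 \<le> 0 * B\<^sup>2 / 2 + lp_pair (grad \<alpha> z) h + 0 * E"
      by (intro tendsto_lowerbound) auto
    then show ?thesis by simp
  qed
  \<comment> \<open>The one-sided limit gives only an inequality; using it for the negated direction
    as well yields equality.\<close>
  have "lp_pair (grad \<alpha> z) (\<lambda>i. (-1) * h i) = - lp_pair (grad \<alpha> z) h"
    using lp_pair_scale_right[OF grad_in_lq[OF z] h, of \<alpha> "-1"] by simp
  with nonneg[OF h] nonneg[OF lp_scale[OF h, of "-1"]] show ?thesis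
    by (simp add: z_def)
qed

text \<open>In the expansion at the minimizer the gradient term vanishes, the square is nonnegative,
  and the linearisation error costs at most the share \<open>s * c * varrho\<close> of the Bregman
  term. The share left is \<open>2 * \<gamma>\<close>.\<close>

lemma quadratic_growth:
  assumes \<alpha>: "\<alpha>s \<le> \<alpha>" and x: "x \<in> lp p"
  shows "2 * \<gamma> * \<alpha> * bregman p x (xa \<alpha>) \<le> \<Phi> \<alpha> x - \<Phi> \<alpha> (xa \<alpha>)"
proof -
  define z where "z = xa \<alpha>"
  have \<alpha>0: "0 < \<alpha>" using \<alpha> \<alpha>s_pos by simp
  have z: "z \<in> lp p" unfolding z_def by (rule xa_in_lp[OF \<alpha>0])
  have "norm (F z - yd) * norm (F x - F z - F' z (x - z)) \<le> (s * varrho * \<alpha>) * (c * bregman p x z)"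
    using residual_le[OF \<alpha>] nonlinearity[OF x z] s_gt_2 varrho_pos \<alpha>0
    by (intro mult_mono) (auto simp: z_def)
  then have "- ((s * varrho * \<alpha>) * (c * bregman p x z)) \<le> (F z - yd) \<bullet> (F x - F z - F' z (x - z))"
    using Cauchy_Schwarz_ineq2[of "F z - yd" "F x - F z - F' z (x - z)"] by linarith
  then have "\<alpha> * bregman p x z - (s * varrho * \<alpha>) * (c * bregman p x z) \<le> \<Phi> \<alpha> x - \<Phi> \<alpha> z"
    unfolding tikhonov_expansion[OF x z]
    using stationary[OF \<alpha>0 lp_diff[OF x z p_ge_1], folded z_def]
      zero_le_power2[of "norm (F x - F z)"]
    by linarith
  moreover have "\<alpha> * bregman p x z - (s * varrho * \<alpha>) * (c * bregman p x z)
      = 2 * \<gamma> * \<alpha> * bregman p x z"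
    by (simp add: \<gamma>_eq field_simps)
  ultimately show ?thesis by (simp add: z_def)
qed

lemma minimizers_lipschitz:
  assumes b: "\<alpha>s \<le> b" and ba: "b \<le> a"
  shows "2 * \<gamma> * \<alpha>s * (p - 1) * lp_norm p (xa b - xa a)
    \<le> (a - b) * (s * varrho * K) * (2 * A) powr (2 - p)"
proof -
  define h where "h = lp_norm p (xa b - xa a)"
  define S where "S = bregman p (xa b) (xa a) + bregman p (xa a) (xa b)"
  have pos: "0 < b" "0 < a" and a: "\<alpha>s \<le> a" using b ba \<alpha>s_pos by auto
  note xl = xa_in_lp[OF pos(1)] xa_in_lp[OF pos(2)]
  have D0: "0 \<le> bregman p (xa b) (xa a)" "0 \<le> bregman p (xa a) (xa b)"
    using bregman_nonneg xl by auto
  have "2 * \<gamma> * \<alpha>s * S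
      \<le> 2 * \<gamma> * a * bregman p (xa b) (xa a) + 2 * \<gamma> * b * bregman p (xa a) (xa b)"
    unfolding S_def distrib_left using \<gamma>_pos a b D0
    by (intro add_mono mult_right_mono) auto
  also have "\<dots> \<le> (\<Phi> a (xa b) - \<Phi> a (xa a)) + (\<Phi> b (xa a) - \<Phi> b (xa b))"
    using quadratic_growth[OF a xl(1)] quadratic_growth[OF b xl(2)] by linarith
  \<comment> \<open>The misfit terms cancel in pairs, leaving the penalties weighted by
    \<open>a - b\<close>.\<close>
  also have "\<dots> = (a - b) * (fp p (xa b) - fp p (xa a))"
    by (simp add: tikhonov_eq algebra_simps)
  also have "\<dots> \<le> (a - b) * (s * varrho * K * h)"
  proof (rule mult_left_mono)
    define u where "u = xa b - xa a"
    have u: "u \<in> lp p" unfolding u_def by (intro lp_diff xl p_ge_1)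
    have swap: "lp_pair (dualmap p (xa b)) (xa a - xa b) = - lp_pair (dualmap p (xa b)) u"
      by (simp add: u_def lp_pair_diff_right xl)
    have "fp p (xa b) - fp p (xa a) \<le> lp_pair (dualmap p (xa b)) u"
      using D0(2) swap by (simp add: bregman_def)
    also have "\<dots> \<le> s * varrho * K * h"
    proof -
      \<comment> \<open>Stationarity at \<open>b\<close> trades the duality map for the adjoint
        applied to the residual. The residual bound is proportional to \<open>b\<close>, so
        \<open>b\<close> cancels; the result is linear in \<open>h\<close>, against the square of
        \<open>h\<close> from monotonicity.\<close>
      have "b * lp_pair (dualmap p (xa b)) u = - ((F (xa b) - yd) \<bullet> F' (xa b) u)"
        using stationary[OF pos(1) u] lp_pair_grad[OF xl(1) u, of b] by simp
      then have "b * lp_pair (dualmap p (xa b)) u \<le> norm (F (xa b) - yd) * norm (F' (xa b) u)"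
        using Cauchy_Schwarz_ineq2[of "F (xa b) - yd" "F' (xa b) u"] by linarith
      also have "\<dots> \<le> (s * varrho * b) * (K * h)"
        using residual_le[OF b] F'_norm_le[OF xl(1) u, of 0] xa_norm_le[OF b]
        by (intro mult_mono) (auto simp: u_def h_def intro: order_trans[OF norm_ge_zero])
      finally have "b * lp_pair (dualmap p (xa b)) u \<le> b * (s * varrho * K * h)"
        by (simp add: mult_ac)
      then show ?thesis using pos(1) by simp
    qed
    finally show "fp p (xa b) - fp p (xa a) \<le> s * varrho * K * h" .
  qed (use ba in simp)
  finally have S_le: "2 * \<gamma> * \<alpha>s * S \<le> (a - b) * (s * varrho * K * h)" .
  define P where "P = (2 * A) powr (2 - p)"
  have "(p - 1) * h\<^sup>2 \<le> S * (lp_norm p (xa b) + lp_norm p (xa a)) powr (2 - p)"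
    using dualmap_monotone[OF xl p_le_2] bregman_symmetric_sum[OF xl] by (simp add: h_def S_def)
  also have "\<dots> \<le> S * P"
    unfolding P_def using xa_norm_le[OF a] xa_norm_le[OF b] p_le_2 D0
    by (intro mult_left_mono powr_mono2) (auto simp: S_def)
  finally have "2 * \<gamma> * \<alpha>s * ((p - 1) * h\<^sup>2) \<le> 2 * \<gamma> * \<alpha>s * (S * P)"
    using \<gamma>_pos \<alpha>s_pos by (intro mult_left_mono) auto
  also have "\<dots> = (2 * \<gamma> * \<alpha>s * S) * P" by simp
  also have "\<dots> \<le> (a - b) * (s * varrho * K * h) * P"
    using S_le by (intro mult_right_mono) (auto simp: P_def)
  finally have *: "h * (2 * \<gamma> * \<alpha>s * (p - 1) * h) \<le> h * ((a - b) * (s * varrho * K) * P)"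
    by (simp add: power2_eq_square mult_ac)
  show ?thesis
  proof (cases "h = 0")
    case True
    then show ?thesis using ba s_gt_2 varrho_pos K_nonneg by (simp add: h_def)
  next
    case False
    then have "0 < h" by (simp add: h_def less_le)
    with * show ?thesis by (simp add: h_def P_def)
  qed
qed

section \<open>Monotonicity of the gradient around a minimizer\<close>

lemma F_diff_le:
  assumes x: "x \<in> lp p" and \<alpha>: "\<alpha>s \<le> \<alpha>" and r: "lp_norm p (x - xa \<alpha>) \<le> r"
  shows "norm (F x - F (xa \<alpha>)) \<le> (K + L * r) * lp_norm p (x - xa \<alpha>)"
proof -
  define z where "z = xa \<alpha>"
  define u where "u = x - z"
  have z: "z \<in> lp p" using xa_in_lp \<alpha> \<alpha>s_pos by (simp add: z_def)
  have u: "u \<in> lp p" unfolding u_def by (intro lp_diff x z p_ge_1)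
  define l where "l t = (\<lambda>i. 1 * z i + t * u i)" for t
  have l: "l t \<in> lp p" for t unfolding l_def by (intro lp_lincomb z u p_ge_1)
  have l_diff: "l t' - l t = (\<lambda>i. (t' - t) * u i)" for t t'
    by (simp add: l_def fun_eq_iff algebra_simps)
  have l_diff_norm: "lp_norm p (l t' - l t) = \<bar>t' - t\<bar> * lp_norm p u" for t t'
    by (simp add: l_diff lp_norm_scale[OF u])
  \<comment> \<open>One is added so that division by \<open>U\<close> is legitimate even if
    \<open>x\<close> is the centre.\<close>
  define U where "U = lp_norm p u + 1"
  have U: "0 < U" "lp_norm p u \<le> U" using lp_norm_nonneg[of p u] unfolding U_def by linarith+
  \<comment> \<open>Restriction to the segment from the centre to \<open>x\<close> permits the mean
    value inequality in a real parameter; the segment stays within distance \<open>r\<close>, where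
    \<open>F'_norm_le\<close> applies.\<close>
  have der: "((\<lambda>t. F (l t)) has_derivative (\<lambda>\<tau>. \<tau> *\<^sub>R F' (l t) u)) (at t within {0..1})" for t
    unfolding has_derivative_within_alt
  proof (intro conjI allI impI)
    show "bounded_linear (\<lambda>\<tau>. \<tau> *\<^sub>R F' (l t) u)" by (rule bounded_linear_scaleR_left)
    fix e :: real assume "0 < e"
    then have "0 < e / U" using U(1) by simp
    then obtain \<eta> where \<eta>: "0 < \<eta>" and "\<forall>w\<in>lp p. lp_norm p (w - l t) < \<eta> \<longrightarrow>
        norm (F w - F (l t) - F' (l t) (w - l t)) \<le> (e / U) * lp_norm p (w - l t)"
      using deriv[OF l, of t] unfolding lp_has_derivative_def by blast
    then have le: "lp_norm p (l t' - l t) < \<eta> \<Longrightarrow>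
        norm (F (l t') - F (l t) - F' (l t) (l t' - l t)) \<le> (e / U) * lp_norm p (l t' - l t)" for t'
      using l by blast
    have "norm (F (l t') - F (l t) - (t' - t) *\<^sub>R F' (l t) u) \<le> e * norm (t' - t)"
      if "norm (t' - t) < \<eta> / U" for t'
    proof -
      have "\<bar>t' - t\<bar> * lp_norm p u \<le> \<bar>t' - t\<bar> * U" using U by (intro mult_left_mono) auto
      also have "\<dots> < \<eta>" using that U by (simp add: field_simps)
      finally have "norm (F (l t') - F (l t) - (t' - t) *\<^sub>R F' (l t) u)
          \<le> (e / U) * (\<bar>t' - t\<bar> * lp_norm p u)"
        using le[of t'] unfolding l_diff_norm
        by (simp add: l_diff lp_bounded_linear_scale[OF F'_bounded_linear[OF l] u])
      also have "\<dots> \<le> (e / U) * (\<bar>t' - t\<bar> * U)"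
        using U \<open>0 < e\<close> by (intro mult_left_mono) auto
      finally show ?thesis using U by simp
    qed
    then show "\<exists>d>0. \<forall>t'\<in>{0..1}. norm (t' - t) < d \<longrightarrow>
        norm (F (l t') - F (l t) - (t' - t) *\<^sub>R F' (l t) u) \<le> e * norm (t' - t)"
      using \<eta> U by (intro exI[of _ "\<eta> / U"]) auto
  qed
  have "norm (F (l 1) - F (l 0)) \<le> ((K + L * r) * lp_norm p u) * norm (1 - 0 :: real)"
  proof (rule differentiable_bound[OF _ der])
    fix t :: real assume t: "t \<in> {0..1}"
    have l0: "l t - z = (\<lambda>i. t * u i)" by (simp add: l_def fun_eq_iff)
    have "t * lp_norm p u \<le> lp_norm p u" using t by (intro mult_left_le_one_le) auto
    also have "\<dots> \<le> r" using r by (simp add: u_def z_def)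
    finally have "lp_norm p (l t - xa \<alpha>) \<le> r"
      using t l0 by (simp add: lp_norm_scale[OF u] flip: z_def)
    from F'_norm_le[OF l u lp_norm_near_xa[OF l \<alpha> this]]
    show "onorm (\<lambda>\<tau>. \<tau> *\<^sub>R F' (l t) u) \<le> (K + L * r) * lp_norm p u"
      by (intro onorm_le) (simp add: mult.commute mult_left_mono)
  qed auto
  moreover have "l 1 = x" "l 0 = z" by (simp_all add: l_def u_def fun_eq_iff)
  ultimately show ?thesis by (simp add: u_def z_def)
qed

text \<open>Relative to the centre, where the gradient vanishes, the penalty contributes
  \<open>\<alpha> * S\<close>. The change of derivative costs the share
  \<open>s * c * varrho\<close> of it, and the change of residual costs
  \<open>\<gamma> * \<alpha> * D\<close> by \<open>small\<close>. Since \<open>D \<le> S\<close>, at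
  least \<open>\<gamma> * \<alpha> * D\<close> survives.\<close>

lemma gradient_monotone:
  assumes x: "x \<in> lp p" and \<alpha>: "\<alpha>s \<le> \<alpha>" and r: "lp_norm p (x - xa \<alpha>) \<le> r"
    and small: "c * ((K + L * r) * r) \<le> \<gamma> * \<alpha>"
  shows "\<gamma> * \<alpha> * bregman p (xa \<alpha>) x \<le> lp_pair (grad \<alpha> x) (x - xa \<alpha>)"
proof -
  define z where "z = xa \<alpha>"
  define u where "u = x - z"
  define e where "e = F x - F z"
  define D where "D = bregman p z x"
  define S where "S = bregman p x z + bregman p z x"
  have \<alpha>0: "0 < \<alpha>" using \<alpha> \<alpha>s_pos by simp
  have z: "z \<in> lp p" using xa_in_lp[OF \<alpha>0] by (simp add: z_def)
  have u: "u \<in> lp p" unfolding u_def by (intro lp_diff x z p_ge_1)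
  have D: "0 \<le> D" "D \<le> S" "0 \<le> S"
    using bregman_nonneg[OF x z] bregman_nonneg[OF z x] by (auto simp: D_def S_def)
  have r0: "0 \<le> r" using r lp_norm_nonneg[of p "x - xa \<alpha>"] by linarith
  have e_le: "norm e \<le> (K + L * r) * r"
  proof -
    have "norm e \<le> (K + L * r) * lp_norm p (x - xa \<alpha>)"
      using F_diff_le[OF x \<alpha> r] by (simp add: e_def z_def)
    also have "\<dots> \<le> (K + L * r) * r"
      using r r0 K_nonneg L_pos by (intro mult_left_mono) auto
    finally show ?thesis .
  qed
  have F'x: "norm (F' x u - e) \<le> c * D"
  proof -
    have "F' x (z - x) = - F' x u"
      using lp_bounded_linear_diff[OF F'_bounded_linear[OF x] z x]
        lp_bounded_linear_diff[OF F'_bounded_linear[OF x] x z] by (simp add: u_def)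
    then have "F z - F x - F' x (z - x) = F' x u - e" by (simp add: e_def)
    then show ?thesis using nonlinearity[OF z x] by (simp add: D_def)
  qed
  have F'z: "norm (e - F' z u) \<le> c * bregman p x z"
    using nonlinearity[OF x z] by (simp add: e_def u_def)
  \<comment> \<open>The derivatives are compared through two linearisation errors, one based at each
    endpoint; each brings its own orientation of the Bregman distance.\<close>
  have "norm (F' x u - F' z u) \<le> c * S"
    using F'x F'z norm_triangle_ineq[of "F' x u - e" "e - F' z u"]
    by (simp add: S_def D_def distrib_left)
  then have "norm (F z - yd) * norm (F' x u - F' z u) \<le> (s * varrho * \<alpha>) * (c * S)"
    using residual_le[OF \<alpha>] s_gt_2 varrho_pos \<alpha>0 by (intro mult_mono) (auto simp: z_def)
  then have t1: "- ((s * varrho * \<alpha>) * (c * S)) \<le> (F z - yd) \<bullet> (F' x u - F' z u)"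
    using Cauchy_Schwarz_ineq2[of "F z - yd" "F' x u - F' z u"] by linarith
  have "norm e * norm (F' x u - e) \<le> ((K + L * r) * r) * (c * D)"
    using F'x e_le D(1) c_pos by (intro mult_mono) (auto intro: order_trans[OF norm_ge_zero])
  also have "\<dots> = (c * ((K + L * r) * r)) * D" by simp
  also have "\<dots> \<le> \<gamma> * \<alpha> * D" using small D(1) by (rule mult_right_mono)
  finally have "- (\<gamma> * \<alpha> * D) \<le> e \<bullet> (F' x u - e)"
    using Cauchy_Schwarz_ineq2[of e "F' x u - e"] by linarith
  \<comment> \<open>The change of residual yields a nonnegative square plus a linearisation error
    based at \<open>x\<close>.\<close>
  moreover have "e \<bullet> F' x u = e \<bullet> e + e \<bullet> (F' x u - e)" by (simp add: inner_diff_right)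
  ultimately have t2: "- (\<gamma> * \<alpha> * D) \<le> e \<bullet> F' x u" using inner_ge_zero[of e] by linarith
  have "lp_pair (grad \<alpha> x) u = lp_pair (grad \<alpha> x) u - lp_pair (grad \<alpha> z) u"
    using stationary[OF \<alpha>0 u] by (simp add: z_def)
  also have "\<dots> = e \<bullet> F' x u + (F z - yd) \<bullet> (F' x u - F' z u)
      + \<alpha> * (lp_pair (dualmap p x) u - lp_pair (dualmap p z) u)"
    unfolding lp_pair_grad[OF x u] lp_pair_grad[OF z u] e_def
    by (simp add: inner_diff_left inner_diff_right algebra_simps)
  also have "lp_pair (dualmap p x) u - lp_pair (dualmap p z) u = S"
    using bregman_symmetric_sum[OF x z] x z u by (simp add: S_def u_def lp_pair_diff_left)
  finally have "\<alpha> * S - (s * varrho * \<alpha>) * (c * S) - \<gamma> * \<alpha> * D \<le> lp_pair (grad \<alpha> x) u"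
    using t1 t2 by linarith
  moreover have "\<alpha> * S - (s * varrho * \<alpha>) * (c * S) = 2 * (\<gamma> * \<alpha> * S)"
    by (simp add: \<gamma>_eq algebra_simps)
  moreover have "\<gamma> * \<alpha> * D \<le> \<gamma> * \<alpha> * S"
    using D \<gamma>_pos \<alpha>0 by (intro mult_left_mono) auto
  ultimately show ?thesis by (simp add: D_def u_def z_def)
qed

subsection \<open>Dual gradient steps\<close>

text \<open>The bound depends on \<open>x\<close> only through \<open>r\<close>, which makes a
  single \<open>M\<close> possible for the whole ball.\<close>

lemma grad_norm_le:
  assumes x: "x \<in> lp p" and \<alpha>: "\<alpha>s \<le> \<alpha>" and r: "lp_norm p (x - xa \<alpha>) \<le> r"
  shows "lp_norm q (grad \<alpha> x)
    \<le> (s * varrho * \<alpha> + (K + L * r) * r) * (K + L * r) + \<alpha> * (A + r) powr (p - 1)"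
proof -
  have \<alpha>0: "0 < \<alpha>" using \<alpha> \<alpha>s_pos by simp
  have r0: "0 \<le> r" using r lp_norm_nonneg[of p "x - xa \<alpha>"] by linarith
  have KL: "0 \<le> K + L * r" using K_nonneg L_pos r0 by simp
  let ?a = "lp_adjoint p q (F' x) (F x - yd)"
  have a: "?a \<in> lp q" by (rule lp_adjoint_in_lq[OF F'_bounded_linear[OF x]])
  have x_le: "lp_norm p x \<le> A + r" by (rule lp_norm_near_xa[OF x \<alpha> r])
  have "norm (F x - F (xa \<alpha>)) \<le> (K + L * r) * r"
    using F_diff_le[OF x \<alpha> r] mult_left_mono[OF r KL] by linarith
  then have F_le: "norm (F x - yd) \<le> s * varrho * \<alpha> + (K + L * r) * r"
    using residual_le[OF \<alpha>] norm_triangle_ineq[of "F x - F (xa \<alpha>)" "F (xa \<alpha>) - yd"] by simp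
  have onorm_le: "lp_onorm p (F' x) \<le> K + L * r"
    by (intro lp_onorm_le KL F'_norm_le[OF x _ x_le])
  have "lp_norm q ?a \<le> norm (F x - yd) * lp_onorm p (F' x)"
    by (rule lp_norm_adjoint[OF F'_bounded_linear[OF x]])
  also have "\<dots> \<le> (s * varrho * \<alpha> + (K + L * r) * r) * (K + L * r)"
    using F_le onorm_le lp_onorm_nonneg[OF F'_bounded_linear[OF x]]
    by (intro mult_mono) (auto intro: order_trans[OF norm_ge_zero])
  finally have a_le: "lp_norm q ?a \<le> (s * varrho * \<alpha> + (K + L * r) * r) * (K + L * r)" .
  have "lp_norm q (grad \<alpha> x) \<le> lp_norm q ?a + lp_norm q (\<lambda>i. \<alpha> * dualmap p x i)"
    unfolding tikhonov_grad_def[abs_def]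
    by (intro lp_norm_triangle a lp_scale dualmap_in_lq x q_ge_1)
  also have "lp_norm q (\<lambda>i. \<alpha> * dualmap p x i) = \<alpha> * lp_norm p x powr (p - 1)"
    using lp_norm_scale[OF dualmap_in_lq[OF x] q_pos] \<alpha>0 by (simp add: lp_norm_dualmap[OF x])
  also have "\<dots> \<le> \<alpha> * (A + r) powr (p - 1)"
    using x_le \<alpha>0 p_gt_1 by (intro mult_left_mono powr_mono2) auto
  finally show ?thesis using a_le by linarith
qed

text \<open>In the three-point identity the mixed term is the gain from
  \<open>gradient_monotone\<close>, and \<open>bregman p x x'\<close> is of order
  \<open>\<beta>\<^sup>2\<close> because the displacement is of order \<open>\<beta>\<close>. Here
  \<open>dualmap_monotone\<close> acts as a Lipschitz bound for the inverse duality map on bounded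
  sets.\<close>

lemma dual_step_bregman_le:
  assumes x: "x \<in> lp p" and \<alpha>: "\<alpha>s \<le> \<alpha>" and r: "lp_norm p (x - xa \<alpha>) \<le> r"
    and small: "c * ((K + L * r) * r) \<le> \<gamma> * \<alpha>"
    and G: "lp_norm q (grad \<alpha> x) \<le> G"
    and \<beta>: "0 \<le> \<beta>" "\<beta> \<le> 1"
    and step: "dualmap p x' = (\<lambda>i. dualmap p x i - \<beta> * grad \<alpha> x i)"
  shows "x' \<in> lp p"
    and "bregman p (xa \<alpha>) x' \<le> bregman p (xa \<alpha>) x - \<beta> * (\<gamma> * \<alpha> * bregman p (xa \<alpha>) x)
      + \<beta>\<^sup>2 * (G\<^sup>2 * (A + r + ((A + r) powr (p - 1) + G) powr (q - 1)) powr (2 - p) / (p - 1))"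
proof -
  have \<alpha>0: "0 < \<alpha>" using \<alpha> \<alpha>s_pos by simp
  have r0: "0 \<le> r" using r lp_norm_nonneg[of p "x - xa \<alpha>"] by linarith
  note z = xa_in_lp[OF \<alpha>0]
  define g where "g = grad \<alpha> x"
  have g: "g \<in> lp q" unfolding g_def by (rule grad_in_lq[OF x])
  have G0: "0 \<le> G" using order_trans[OF lp_norm_nonneg G] .
  \<comment> \<open>Bounds the dual norm of the new iterate for every
    \<open>\<beta> \<le> 1\<close>; its power \<open>q - 1\<close> bounds \<open>x'\<close> itself,
    so the monotonicity factor \<open>B\<close> is uniform.\<close>
  define X where "X = (A + r) powr (p - 1) + G"
  have x_le: "lp_norm p x \<le> A + r" by (rule lp_norm_near_xa[OF x \<alpha> r])
  have J': "dualmap p x' = (\<lambda>i. 1 * dualmap p x i + (-\<beta>) * g i)" by (simp add: step g_def)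
  have J'_lq: "dualmap p x' \<in> lp q"
    unfolding J' by (intro lp_lincomb dualmap_in_lq x g q_ge_1)
  show x': "x' \<in> lp p"
    using lp_exponents.dualmap_in_lq[OF swapped J'_lq] by simp
  have "lp_norm p x' powr (p - 1) = lp_norm q (dualmap p x')" by (simp add: lp_norm_dualmap[OF x'])
  also have "\<dots> \<le> lp_norm q (\<lambda>i. 1 * dualmap p x i) + lp_norm q (\<lambda>i. (-\<beta>) * g i)"
    unfolding J' by (intro lp_norm_triangle lp_scale dualmap_in_lq x g q_ge_1)
  also have "\<dots> = lp_norm p x powr (p - 1) + \<beta> * lp_norm q g"
    using lp_norm_scale[OF g q_pos, of "-\<beta>"] \<beta> by (simp add: lp_norm_dualmap[OF x])
  also have "\<dots> \<le> X"
  proof -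
    have "lp_norm p x powr (p - 1) \<le> (A + r) powr (p - 1)"
      using x_le p_gt_1 by (intro powr_mono2) auto
    moreover have "\<beta> * lp_norm q g \<le> 1 * G"
      using \<beta> G by (intro mult_mono) (auto simp: g_def)
    ultimately show ?thesis by (simp add: X_def)
  qed
  finally have "(lp_norm p x' powr (p - 1)) powr (q - 1) \<le> X powr (q - 1)"
    using q_gt_1 by (intro powr_mono2) auto
  then have x'_le: "lp_norm p x' \<le> X powr (q - 1)" by (simp add: powr_powr)
  define B where "B = (A + r + X powr (q - 1)) powr (2 - p)"
  define h where "h = lp_norm p (x - x')"
  define S where "S = lp_pair (dualmap p x - dualmap p x') (x - x')"
  have h0: "0 \<le> h" by (simp add: h_def)
  have B0: "0 \<le> B" by (simp add: B_def)
  have J_diff: "dualmap p x - dualmap p x' = (\<lambda>i. \<beta> * g i)" by (simp add: J' fun_eq_iff)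
  have pair_J: "lp_pair (dualmap p x - dualmap p x') v = \<beta> * lp_pair g v" if "v \<in> lp p" for v
    using lp_pair_lincomb_left[OF g g that, of \<beta> 0] by (simp add: J_diff)
  have xx': "x - x' \<in> lp p" by (intro lp_diff x x' p_ge_1)
  have "lp_pair g (x - x') \<le> G * h"
  proof -
    have "lp_norm q g * h \<le> G * h" using G by (intro mult_right_mono) (auto simp: g_def h_def)
    then show ?thesis using lp_pair_bound[OF g xx'] by (simp add: h_def)
  qed
  then have S_le: "S \<le> \<beta> * (G * h)"
    using \<beta> by (simp add: S_def pair_J[OF xx'] mult_left_mono)
  have S0: "0 \<le> S"
    using bregman_nonneg[OF x x'] bregman_nonneg[OF x' x] bregman_symmetric_sum[OF x x']
    by (simp add: S_def)
  \<comment> \<open>Monotonicity puts the square of \<open>h\<close> below a multiple of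
    \<open>S\<close>, and the gradient bound puts \<open>S\<close> below
    \<open>\<beta> * (G * h)\<close>; dividing by \<open>h\<close> makes the displacement linear in
    \<open>\<beta>\<close>.\<close>
  have "(p - 1) * h\<^sup>2 \<le> S * (lp_norm p x + lp_norm p x') powr (2 - p)"
    using dualmap_monotone[OF x x' p_le_2] by (simp add: S_def h_def)
  also have "\<dots> \<le> S * B"
    unfolding B_def using x_le x'_le p_le_2 S0 by (intro mult_left_mono powr_mono2) auto
  also have "\<dots> \<le> (\<beta> * (G * h)) * B" using S_le B0 by (rule mult_right_mono)
  finally have *: "h * ((p - 1) * h) \<le> h * (\<beta> * G * B)"
    by (simp add: power2_eq_square mult_ac)
  have h_le: "h \<le> \<beta> * G * B / (p - 1)"
  proof (cases "h = 0")
    case True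
    then show ?thesis using \<beta> G0 B0 p_gt_1 by simp
  next
    case False
    then have "(p - 1) * h \<le> \<beta> * G * B" using * h0 by simp
    then show ?thesis using p_gt_1 by (simp add: field_simps)
  qed
  have "bregman p x x' \<le> S"
    using bregman_nonneg[OF x x'] bregman_symmetric_sum[OF x x'] by (simp add: S_def)
  also have "\<dots> \<le> \<beta> * (G * (\<beta> * G * B / (p - 1)))"
    using S_le \<beta> G0 mult_left_mono[OF mult_left_mono[OF h_le G0] \<beta>(1)] by linarith
  also have "\<dots> = \<beta>\<^sup>2 * (G\<^sup>2 * B / (p - 1))" by (simp add: power2_eq_square)
  finally have D_le: "bregman p x x' \<le> \<beta>\<^sup>2 * (G\<^sup>2 * B / (p - 1))" .
  have zx: "xa \<alpha> - x \<in> lp p" by (intro lp_diff z x p_ge_1)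
  have "lp_pair (dualmap p x - dualmap p x') (xa \<alpha> - x) = - (\<beta> * lp_pair g (x - xa \<alpha>))"
    unfolding pair_J[OF zx] using g x z by (simp add: lp_pair_diff_right algebra_simps)
  also have "\<dots> \<le> - (\<beta> * (\<gamma> * \<alpha> * bregman p (xa \<alpha>) x))"
    using mult_left_mono[OF gradient_monotone[OF x \<alpha> r small] \<beta>(1)] by (simp add: g_def)
  finally show "bregman p (xa \<alpha>) x' \<le> bregman p (xa \<alpha>) x - \<beta> * (\<gamma> * \<alpha> * bregman p (xa \<alpha>) x)
      + \<beta>\<^sup>2 * (G\<^sup>2 * (A + r + ((A + r) powr (p - 1) + G) powr (q - 1)) powr (2 - p) / (p - 1))"
    using bregman_three_point[OF x x' z] D_le unfolding B_def X_def by linarith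
qed

text \<open>Far from the centre, i.e. at distance at least \<open>d / 2\<close>, a short step decreases the
  distance; near it, a short step cannot leave the ball.\<close>

lemma bregman_ball_invariant:
  assumes \<alpha>: "\<alpha>s \<le> \<alpha>" and d: "0 < d" and r: "0 \<le> r"
    and ball: "bregman_ball p (xa \<alpha>) d \<subseteq> lp_cball p (xa \<alpha>) r"
    and small: "c * ((K + L * r) * r) \<le> \<gamma> * \<alpha>"
  obtains M where "0 < M"
    "\<And>x x' \<beta>. x \<in> bregman_ball p (xa \<alpha>) d \<Longrightarrow> 0 \<le> \<beta> \<Longrightarrow> \<beta> \<le> 1 / (2 * M) \<Longrightarrow>
      dualmap p x' = (\<lambda>i. dualmap p x i - \<beta> * grad \<alpha> x i) \<Longrightarrow> x' \<in> bregman_ball p (xa \<alpha>) d"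
proof -
  define G where
    "G = (s * varrho * \<alpha> + (K + L * r) * r) * (K + L * r) + \<alpha> * (A + r) powr (p - 1)"
  define Q where
    "Q = G\<^sup>2 * (A + r + ((A + r) powr (p - 1) + G) powr (q - 1)) powr (2 - p) / (p - 1)"
  \<comment> \<open>\<open>M\<close> is chosen to give \<open>\<beta> * Q \<le> m / 2\<close>. With
    \<open>m \<le> \<gamma> * \<alpha> * d\<close> the gain outweighs the second-order term in the
    outer region; with \<open>m \<le> d\<close> that term stays below \<open>d / 2\<close> in the
    inner one.\<close>
  define m where "m = min (\<gamma> * \<alpha>) 1 * d"
  define M where "M = max 1 (Q / m)"
  have \<alpha>0: "0 < \<alpha>" using \<alpha> \<alpha>s_pos by simp
  have Q0: "0 \<le> Q" using p_gt_1 by (simp add: Q_def)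
  have m: "0 < m" "m \<le> \<gamma> * \<alpha> * d" "m \<le> d"
    using \<gamma>_pos \<alpha>0 d by (auto simp: m_def min_def)
  show thesis
  proof (rule that[of M])
    show M0: "0 < M" by (simp add: M_def)
    fix x x' \<beta>
    assume x_ball: "x \<in> bregman_ball p (xa \<alpha>) d" and \<beta>: "0 \<le> \<beta>" "\<beta> \<le> 1 / (2 * M)"
      and step: "dualmap p x' = (\<lambda>i. dualmap p x i - \<beta> * grad \<alpha> x i)"
    define D where "D = bregman p (xa \<alpha>) x"
    have x: "x \<in> lp p" and D_le: "D \<le> d" and xr: "lp_norm p (x - xa \<alpha>) \<le> r"
      using x_ball ball by (auto simp: bregman_ball_def lp_cball_def D_def)
    have D0: "0 \<le> D" unfolding D_def by (rule bregman_nonneg[OF x xa_in_lp[OF \<alpha>0]])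
    have "1 / (2 * M) \<le> 1" by (simp add: M_def)
    then have \<beta>1: "\<beta> \<le> 1" using \<beta> by linarith
    have "\<beta> * Q \<le> 1 / (2 * M) * (M * m)"
      using \<beta> Q0 m M0 by (intro mult_mono) (auto simp: M_def max_def field_simps)
    also have "\<dots> = m / 2" using M0 by simp
    finally have \<beta>Q: "\<beta> * Q \<le> m / 2" .
    note * = dual_step_bregman_le[OF x \<alpha> xr small grad_norm_le[OF x \<alpha> xr, folded G_def]
        \<beta>(1) \<beta>1 step, folded Q_def D_def]
    have "bregman p (xa \<alpha>) x' \<le> d"
    proof (cases "D \<le> d / 2")
      case True
      have "\<beta>\<^sup>2 * Q = \<beta> * (\<beta> * Q)" by (simp add: power2_eq_square)
      also have "\<dots> \<le> 1 * (m / 2)" using \<beta> \<beta>1 \<beta>Q Q0 by (intro mult_mono) auto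
      finally have "\<beta>\<^sup>2 * Q \<le> d / 2" using m by simp
      moreover have "0 \<le> \<beta> * (\<gamma> * \<alpha> * D)" using \<beta> \<gamma>_pos \<alpha>0 D0 by simp
      ultimately show ?thesis using *(2) True by linarith
    next
      case False
      have "\<gamma> * \<alpha> * (d / 2) \<le> \<gamma> * \<alpha> * D" using False \<gamma>_pos \<alpha>0 by (intro mult_left_mono) auto
      then have "\<beta> * Q \<le> \<gamma> * \<alpha> * D" using \<beta>Q m(2) by simp
      then have "\<beta> * (\<beta> * Q) \<le> \<beta> * (\<gamma> * \<alpha> * D)" using \<beta>(1) by (rule mult_left_mono)
      then have "\<beta>\<^sup>2 * Q \<le> \<beta> * (\<gamma> * \<alpha> * D)" by (simp add: power2_eq_square mult.assoc)
      then show ?thesis using *(2) D_le by linarith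
    qed
    then show "x' \<in> bregman_ball p (xa \<alpha>) d" using *(1) by (simp add: bregman_ball_def)
  qed
qed

text \<open>At \<open>t = 0\<close> the ray is at \<open>x\<close>, and the functional is bounded
  below by zero. Hence the decrease in the numerator of \<open>cbar\<close> is nonnegative.\<close>

lemma tikhonov_linemin_le:
  "tikhonov_linemin p q F F' yd \<alpha> x \<le> \<Phi> \<alpha> x" if "0 < \<alpha>"
proof -
  have "bdd_below ((\<lambda>t. \<Phi> \<alpha> (dualmap q (\<lambda>i. dualmap p x i - t * grad \<alpha> x i))) ` {0..})"
    using that fp_nonneg by (intro bdd_belowI2[of _ 0]) (simp add: tikhonov_eq)
  from cINF_lower[OF this, of 0] show ?thesis by (simp add: tikhonov_linemin_def)
qed

text \<open>The three-point identity splits the distance to the new centre into the distance to the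
  old one, controlled by the gradient, and two terms controlled by the shift of the centre.\<close>

lemma next_bregman_ball:
  assumes b: "\<alpha>s \<le> b" "\<alpha>s \<le> a"
    and x: "x \<in> lp p" and r: "lp_norm p (x - xa a) \<le> r"
    and small: "c * ((K + L * r) * r) \<le> \<gamma> * a"
    and g: "lp_norm q (grad a x) * r \<le> \<gamma> * a * (d / 3)"
    and \<rho>: "ct powr (1 / p) \<le> \<rho>" "2 * A powr (p - 1) + r powr (p - 1) \<le> \<rho>"
    and h: "\<rho> * lp_norm p (xa b - xa a) \<le> d / 3" "\<rho> * lp_norm p (xa b - xa a) \<le> 1"
  shows "x \<in> bregman_ball p (xa b) d"
proof -
  have pos: "0 < a" "0 < b" using b \<alpha>s_pos by auto
  note zl = xa_in_lp[OF pos(1)] xa_in_lp[OF pos(2)]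
  define \<eta> where "\<eta> = lp_norm p (xa b - xa a)"
  have \<rho>0: "0 \<le> \<rho>" using \<rho>(1) powr_ge_zero[of ct "1/p"] by linarith
  have \<eta>0: "0 \<le> \<eta>" by (simp add: \<eta>_def)
  have r0: "0 \<le> r" using r lp_norm_nonneg[of p "x - xa a"] by linarith
  have "\<gamma> * a * bregman p (xa a) x \<le> lp_norm q (grad a x) * lp_norm p (x - xa a)"
    using gradient_monotone[OF x b(2) r small]
      lp_pair_bound[OF grad_in_lq[OF x] lp_diff[OF x zl(1) p_ge_1], of a] by linarith
  also have "\<dots> \<le> lp_norm q (grad a x) * r" using r by (intro mult_left_mono) auto
  also have "\<dots> \<le> \<gamma> * a * (d / 3)" by (rule g)
  finally have D1: "bregman p (xa a) x \<le> d / 3" using \<gamma>_pos pos by simp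
  have "bregman p (xa b) (xa a) \<le> ct * \<eta> powr p"
    using bregman_le[OF zl] by (simp add: \<eta>_def lp_norm_minus_commute[of p "xa b"])
  also have "\<dots> = (ct powr (1/p) * \<eta>) powr p"
    using ct_pos \<eta>0 by (simp add: powr_mult powr_powr)
  also have "\<dots> \<le> (\<rho> * \<eta>) powr p"
    using \<rho>(1) \<eta>0 by (intro powr_mono2 mult_right_mono) auto
  \<comment> \<open>Since \<open>\<rho> * \<eta> \<le> 1\<close>, the power \<open>p\<close> may be
    lowered to one, and the same smallness condition serves here and for the mixed term.\<close>
  also have "\<dots> \<le> (\<rho> * \<eta>) powr 1"
    using h(2) \<rho>0 \<eta>0 by (intro powr_mono') (auto simp: \<eta>_def)
  also have "\<dots> \<le> d / 3" using h(1) \<rho>0 \<eta>0 by (simp add: \<eta>_def)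
  finally have D2: "bregman p (xa b) (xa a) \<le> d / 3" .
  \<comment> \<open>As \<open>p - 1 \<le> 1\<close>, the power is subadditive; this gives the second
    entry of the maximum defining \<open>\<rho>\<close>.\<close>
  have sub: "(A + r) powr (p - 1) \<le> A powr (p - 1) + r powr (p - 1)"
    using p_gt_1 p_le_2 A_nonneg r0 by (intro powr_subadditive) auto
  have J: "lp_norm q (dualmap p (xa a) - dualmap p x) \<le> \<rho>"
  proof -
    have "lp_norm q (dualmap p (xa a) - dualmap p x) \<le> lp_norm p (xa a) powr (p - 1) + lp_norm p x powr (p - 1)"
      using lp_norm_diff_le[OF dualmap_in_lq[OF zl(1)] dualmap_in_lq[OF x] q_ge_1]
      by (simp add: lp_norm_dualmap x zl)
    also have "\<dots> \<le> A powr (p - 1) + (A + r) powr (p - 1)"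
      using p_gt_1 xa_norm_le[OF b(2)] lp_norm_near_xa[OF x b(2) r]
      by (intro add_mono powr_mono2) auto
    finally show ?thesis using sub \<rho>(2) by linarith
  qed
  have "lp_pair (dualmap p (xa a) - dualmap p x) (xa b - xa a)
      \<le> lp_norm q (dualmap p (xa a) - dualmap p x) * \<eta>"
    using lp_pair_bound[OF lp_diff[OF dualmap_in_lq[OF zl(1)] dualmap_in_lq[OF x] q_ge_1]
        lp_diff[OF zl(2) zl(1) p_ge_1]] by (simp add: \<eta>_def)
  also have "\<dots> \<le> \<rho> * \<eta>" using J \<eta>0 by (rule mult_right_mono)
  also have "\<dots> \<le> d / 3" using h(1) by (simp add: \<eta>_def)
  finally have D3: "lp_pair (dualmap p (xa a) - dualmap p x) (xa b - xa a) \<le> d / 3" .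
  have "bregman p (xa b) x \<le> d"
    using bregman_three_point[OF zl(1) x zl(2)] D1 D2 D3 by linarith
  then show ?thesis using x by (simp add: bregman_ball_def)
qed

text \<open>Recasts \<open>minimizers_lipschitz\<close> with the prescribed \<open>\<sigma>\<close>.
  As \<open>0 powr 0 = 0\<close>, the factor in \<open>cA\<close> is set to \<open>1\<close>
  explicitly for \<open>p = 2\<close>. For \<open>A = 0\<close> and \<open>p < 2\<close> the right
  side of the estimate is zero, which forces equal minimizers and fits
  \<open>\<sigma> = 0\<close>.\<close>

lemma minimizers_distance_le:
  assumes b: "\<alpha>s \<le> b" "b \<le> a"
    and cA: "cA = (p - 1) / 2 * (if p = 2 then 1 else (3 * A) powr (p - 2))"
    and \<sigma>: "\<sigma> = (if A = 0 \<and> p < 2 then 0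
      else 2 * s * varrho * K / (cA * (1 - s * c * varrho) * \<alpha>s))"
  shows "0 \<le> \<sigma>" and "lp_norm p (xa b - xa a) \<le> \<sigma> * (a - b)"
proof -
  define \<eta> where "\<eta> = lp_norm p (xa b - xa a)"
  define N where "N = s * varrho * K"
  define W where "W = (if p = 2 then 1 else (3 * A) powr (p - 2))"
  have N0: "0 \<le> N" using s_gt_2 varrho_pos K_nonneg by (simp add: N_def)
  have pos: "0 < 2 * \<gamma> * \<alpha>s" using \<gamma>_pos \<alpha>s_pos by simp
  have lip: "2 * \<gamma> * \<alpha>s * (p - 1) * \<eta> \<le> (a - b) * N * (2 * A) powr (2 - p)"
    using minimizers_lipschitz[OF b] by (simp add: \<eta>_def N_def)
  have \<gamma>2: "1 - s * c * varrho = 2 * \<gamma>" by (simp add: \<gamma>_eq)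
  have cA0: "0 \<le> cA" using p_gt_1 by (simp add: cA)
  show "0 \<le> \<sigma>"
    using cA0 N0 \<gamma>_pos \<alpha>s_pos unfolding \<sigma> \<gamma>2 N_def by (simp add: mult.assoc)
  show "lp_norm p (xa b - xa a) \<le> \<sigma> * (a - b)"
  proof (cases "A = 0 \<and> p < 2")
    case True
    then have "2 * \<gamma> * \<alpha>s * (p - 1) * \<eta> \<le> 0" using lip by simp
    moreover have "0 < 2 * \<gamma> * \<alpha>s * (p - 1)" using \<gamma>_pos \<alpha>s_pos p_gt_1 by simp
    ultimately have "\<eta> \<le> 0" by (metis mult_pos_pos not_le)
    then show ?thesis using True by (simp add: \<sigma> \<eta>_def)
  next
    case False
    have W: "0 < W" "W * (2 * A) powr (2 - p) \<le> 1"
    proof -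
      show "0 < W" using False A_nonneg p_le_2 by (auto simp: W_def)
      show "W * (2 * A) powr (2 - p) \<le> 1"
      proof (cases "p = 2")
        case True
        then show ?thesis by (simp add: W_def)
      next
        case p: False
        then have A: "0 < A" using False A_nonneg p_le_2 by auto
        have "W * (2 * A) powr (2 - p) \<le> W * (3 * A) powr (2 - p)"
          using A p_le_2 \<open>0 < W\<close> by (intro mult_left_mono powr_mono2) auto
        also have "\<dots> = (3 * A) powr (p - 2 + (2 - p))"
          using p by (simp only: W_def powr_add if_False)
        also have "\<dots> = 1" using A by simp
        finally show ?thesis .
      qed
    qed
    have cA_W: "cA = (p - 1) / 2 * W" by (simp add: cA W_def)
    have cA_pos: "0 < cA" unfolding cA_W using W p_gt_1 by (intro mult_pos_pos) auto
    have "2 * \<gamma> * \<alpha>s * cA * \<eta> = W / 2 * (2 * \<gamma> * \<alpha>s * (p - 1) * \<eta>)" by (simp add: cA_W)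
    also have "\<dots> \<le> W / 2 * ((a - b) * N * (2 * A) powr (2 - p))"
      using W by (intro mult_left_mono lip) auto
    also have "\<dots> = (a - b) * N / 2 * (W * (2 * A) powr (2 - p))" by simp
    also have "\<dots> \<le> (a - b) * N / 2"
      using b N0 by (intro mult_left_le W) auto
    \<comment> \<open>A factor of four is given away to match the constant in
      \<open>\<sigma>\<close>.\<close>
    also have "\<dots> \<le> (a - b) * (2 * N)"
      using mult_nonneg_nonneg[of "a - b" N] b N0 by simp
    finally have le: "2 * \<gamma> * \<alpha>s * cA * \<eta> \<le> (a - b) * (2 * N)" .
    have "\<sigma> = 2 * s * varrho * K / (cA * (1 - s * c * varrho) * \<alpha>s)"
      unfolding \<sigma> by (rule if_not_P[OF False])
    then have \<sigma>_N: "\<sigma> = 2 * N / (2 * \<gamma> * \<alpha>s * cA)"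
      unfolding \<gamma>2 by (simp add: N_def mult_ac)
    have "0 < 2 * \<gamma> * \<alpha>s * cA" using pos cA_pos by (rule mult_pos_pos)
    with le have "\<eta> \<le> (a - b) * (2 * N) / (2 * \<gamma> * \<alpha>s * cA)"
      by (simp only: pos_le_divide_eq mult.commute[of \<eta>])
    also have "\<dots> = \<sigma> * (a - b)" using \<sigma>_N by simp
    finally show ?thesis by (simp add: \<eta>_def)
  qed
qed

end

text \<open>The first entry of the minimum keeps the part of the product linear in \<open>r\<close>
  below \<open>t / 3\<close>, the second keeps the quadratic part below \<open>t / 10\<close>, and
  the prefactor is at most one. For \<open>K = 0\<close> the linear part is zero.\<close>

lemma step_radius:
  fixes c K L t :: real
  assumes "0 < c" "0 < L" "0 \<le> K" "0 < t"
    and r: "r = 2 / (1 + sqrt 2) *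
      (if K = 0 then sqrt (t / (10 * c * L)) else min (t / (3 * c * K)) (sqrt (t / (10 * c * L))))"
  shows "0 < r" and "c * ((K + L * r) * r) \<le> t"
proof -
  define X where "X = sqrt (t / (10 * c * L))"
  define m where "m = (if K = 0 then X else min (t / (3 * c * K)) X)"
  define \<kappa> where "\<kappa> = 2 / (1 + sqrt 2)"
  have \<kappa>: "0 < \<kappa>" "\<kappa> \<le> 1" by (auto simp: \<kappa>_def add_pos_nonneg)
  have X0: "0 < X" using assms by (simp add: X_def)
  have m0: "0 < m" using X0 assms by (simp add: m_def)
  have rm: "r = \<kappa> * m" by (simp add: r m_def X_def \<kappa>_def)
  show r0: "0 < r" using \<kappa> m0 by (simp add: rm)
  have r_le: "r \<le> m" using \<kappa> m0 by (simp add: rm)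
  have "c * K * r \<le> t / 3"
  proof (cases "K = 0")
    case False
    have "c * K * r \<le> c * K * (t / (3 * c * K))"
      using r_le False assms by (intro mult_left_mono) (auto simp: m_def)
    then show ?thesis using False assms by simp
  qed (use assms in simp)
  moreover have "c * L * r\<^sup>2 \<le> t / 10"
  proof -
    have "r\<^sup>2 \<le> X\<^sup>2" using r_le r0 by (intro power_mono) (auto simp: m_def split: if_splits)
    also have "\<dots> = t / (10 * c * L)" using assms by (simp add: X_def)
    finally have "c * L * r\<^sup>2 \<le> c * L * (t / (10 * c * L))"
      using assms by (intro mult_left_mono) auto
    then show ?thesis using assms by simp
  qed
  ultimately have "c * K * r + c * L * r\<^sup>2 \<le> t" using assms by linarith
  then show "c * ((K + L * r) * r) \<le> t" by (simp add: power2_eq_square algebra_simps)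
qed

section \<open>Assembly of the estimates along one run of the iteration\<close>

theorem proposition3p11:
  fixes p q \<delta> ct L c s varrho :: real
    and F :: "(nat \<Rightarrow> real) \<Rightarrow> 'y::{real_inner, complete_space}"
    and F' :: "(nat \<Rightarrow> real) \<Rightarrow> (nat \<Rightarrow> real) \<Rightarrow> 'y"
    and y yd \<omega> :: 'y
    and xdag xbar0 :: "nat \<Rightarrow> real"
    and xa :: "real \<Rightarrow> nat \<Rightarrow> real"
    and r d :: "real \<Rightarrow> real"
    and \<alpha>s A K \<gamma> qbar0 cA \<sigma> \<rho> \<alpha>0 qbar \<alpha>j \<alpha>j1 cAbar :: real
    and cbar :: "(nat \<Rightarrow> real) \<Rightarrow> real"
  assumes p: "1 < p" "p \<le> 2" and q: "1 / p + 1 / q = 1"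
    and F_closed: "lp_weakly_seq_closed p q F"
    and y: "y \<in> F ` lp p" and \<delta>: "\<delta> > 0" and yd: "norm (y - yd) \<le> \<delta>"
    and ct: "ct > 0" "\<forall>x\<in>lp p. \<forall>z\<in>lp p. bregman p z x \<le> ct * lp_norm p (x - z) powr p"
    and F': "\<forall>x\<in>lp p. lp_has_derivative p F (F' x) x"
    and L: "L > 0"
      "\<forall>x\<in>lp p. \<forall>z\<in>lp p. lp_onorm p (\<lambda>h. F' x h - F' z h) \<le> L * lp_norm p (x - z)"
    and c: "c > 0"
      "\<forall>x\<in>lp p. \<forall>z\<in>lp p. norm (F x - F z - F' z (x - z)) \<le> c * bregman p x z"
    and s: "s > 2" and varrho: "0 < varrho" "varrho < 1 / (s * c)"
    and xdag: "fp_minimizing_solution p F y xdag"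
    and \<omega>: "norm \<omega> \<le> varrho" "dualmap p xdag = lp_adjoint p q (F' xdag) \<omega>"
    and xa: "\<forall>\<alpha>>0. tikhonov_minimizer p F yd \<alpha> (xa \<alpha>)"
    and \<alpha>s_eq: "\<alpha>s = \<delta> / ((s - 2) * varrho)"
    and A_eq: "A = (p / (2 * \<alpha>s)) powr (1 / p) * norm (F (\<lambda>_. 0) - yd) powr (2 / p)"
    and K_eq: "K = L * A + lp_onorm p (F' (\<lambda>_. 0))"
    and \<gamma>_eq: "\<gamma> = (1 - s * c * varrho) / 2"
    and r_eq: "\<forall>\<alpha>\<ge>\<alpha>s. r \<alpha> = 2 / (1 + sqrt 2) *
      (if K = 0 then sqrt (\<gamma> * \<alpha> / (10 * c * L))
       else min (\<gamma> * \<alpha> / (3 * c * K)) (sqrt (\<gamma> * \<alpha> / (10 * c * L))))"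
    and qbar0_eq: "qbar0 = 2 * s * c * varrho / (1 + s * c * varrho)"
    and cA_eq: "cA = (p - 1) / 2 * (if p = 2 then 1 else (3 * A) powr (p - 2))"
    and \<sigma>_eq: "\<sigma> = (if A = 0 \<and> p < 2 then 0
      else 2 * s * varrho * K / (cA * (1 - s * c * varrho) * \<alpha>s))"
    and \<rho>_eq: "\<rho> = max (ct powr (1 / p)) (2 * A powr (p - 1) + r \<alpha>0 powr (p - 1))"
    and d: "\<forall>\<alpha>\<ge>\<alpha>s. d \<alpha> > 0" "continuous_on {\<alpha>s..} d" "strict_mono_on {\<alpha>s..} d"
      "filterlim d at_top at_top"
      "\<forall>\<alpha>\<ge>\<alpha>s. bregman_ball p (xa \<alpha>) (d \<alpha>) \<subseteq> lp_cball p (xa \<alpha>) (r \<alpha>)"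
    and \<alpha>0: "\<alpha>0 > \<alpha>s"
    and xbar0: "xbar0 \<in> lp p" "bregman p (xa \<alpha>0) xbar0 \<le> d \<alpha>0"
    and qbar: "qbar0 < qbar" "qbar < 1" "\<rho> * \<sigma> * \<alpha>0 * (1 - qbar) \<le> min (d \<alpha>s / 3) 1"
    and \<alpha>j: "\<alpha>s \<le> \<alpha>j" "\<alpha>j \<le> \<alpha>0"
    and \<alpha>j1_eq: "\<alpha>j1 = max (qbar * \<alpha>j) \<alpha>s"
    and cAbar_eq: "cAbar = (p - 1) / 2 * (2 * r \<alpha>j + A) powr (p - 2)"
    and cbar_eq: "\<forall>x\<in>lp p. cbar x = min 1
      (8 * cAbar * (tikhonov p F yd \<alpha>j x - tikhonov_linemin p q F F' yd \<alpha>j x) /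
       (4 * K\<^sup>2 + 4 * L * s * varrho * \<alpha>j + 4 * L * K * r \<alpha>j + L\<^sup>2 * (r \<alpha>j)\<^sup>2
        + 8 * \<alpha>j * ct * cAbar powr ((2 - p) / 2)))"
  shows "\<exists>M>0. \<forall>x C kstar.
      x 0 \<in> bregman_ball p (xa \<alpha>j) (d \<alpha>j) \<longrightarrow>
      dual_gradient_iteration p q (tikhonov_grad p q F F' yd \<alpha>j) \<gamma> cbar \<alpha>j M x \<longrightarrow>
      0 < C \<longrightarrow> C \<le> \<gamma> * \<alpha>j * d \<alpha>j1 / (3 * r \<alpha>j) \<longrightarrow>
      lp_norm q (tikhonov_grad p q F F' yd \<alpha>j (x kstar)) \<le> C \<longrightarrow>
      (\<forall>k<kstar. \<not> lp_norm q (tikhonov_grad p q F F' yd \<alpha>j (x k)) \<le> C) \<longrightarrow>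
      x kstar \<in> bregman_ball p (xa \<alpha>j1) (d \<alpha>j1)"
proof -
  have sc: "0 < s * c" using s c by simp
  interpret T: tikhonov_source_condition p q F F' yd \<omega> xdag xa \<delta> ct L c s varrho \<alpha>s A K \<gamma>
  proof unfold_locales
    show "norm (F xdag - yd) \<le> \<delta>" "xdag \<in> lp p"
      using xdag yd by (auto simp: fp_minimizing_solution_def)
    show "s * c * varrho < 1" using varrho sc by (simp add: field_simps)
  qed (use assms in blast)+
  define b where "b = \<alpha>j1"
  have \<alpha>j_pos: "0 < \<alpha>j" using \<alpha>j T.\<alpha>s_pos by simp
  have b: "\<alpha>s \<le> b" "b \<le> \<alpha>j"
    using qbar \<alpha>j \<alpha>j_pos by (auto simp: b_def \<alpha>j1_eq)
  \<comment> \<open>The maximum with \<open>\<alpha>s\<close> can only shorten the decrement, which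
    is thus at most the fraction \<open>1 - qbar\<close> of \<open>\<alpha>j\<close>.\<close>
  have shift: "\<alpha>j - b \<le> \<alpha>0 * (1 - qbar)"
  proof -
    have "\<alpha>j - b \<le> \<alpha>j * (1 - qbar)" by (simp add: b_def \<alpha>j1_eq algebra_simps)
    also have "\<dots> \<le> \<alpha>0 * (1 - qbar)" using \<alpha>j qbar by (intro mult_right_mono) auto
    finally show ?thesis .
  qed
  have radius: "0 < r \<alpha>" "c * ((K + L * r \<alpha>) * r \<alpha>) \<le> \<gamma> * \<alpha>" if "\<alpha>s \<le> \<alpha>" for \<alpha>
    using step_radius[OF c(1) L(1) T.K_nonneg _ r_eq[rule_format, OF that]] that
      T.\<gamma>_pos T.\<alpha>s_pos by auto
  \<comment> \<open>\<open>\<rho>\<close> is formed with the radius at \<open>\<alpha>0\<close>, but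
    the centre shift needs the one at \<open>\<alpha>j\<close>.\<close>
  have r_mono: "r \<alpha>j \<le> r \<alpha>0"
  proof -
    have "\<gamma> * \<alpha>j \<le> \<gamma> * \<alpha>0" using T.\<gamma>_pos \<alpha>j by (intro mult_left_mono) auto
    then have "\<gamma> * \<alpha>j / (3 * c * K) \<le> \<gamma> * \<alpha>0 / (3 * c * K)"
      "sqrt (\<gamma> * \<alpha>j / (10 * c * L)) \<le> sqrt (\<gamma> * \<alpha>0 / (10 * c * L))"
      using c(1) L(1) T.K_nonneg by (auto intro!: divide_right_mono)
    then show ?thesis
      using \<alpha>j by (auto simp: r_eq intro!: mult_left_mono min.mono divide_right_mono)
  qed
  obtain M where M: "0 < M" "\<And>x x' \<beta>. x \<in> bregman_ball p (xa \<alpha>j) (d \<alpha>j) \<Longrightarrow> 0 \<le> \<beta> \<Longrightarrow>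
      \<beta> \<le> 1 / (2 * M) \<Longrightarrow>
      dualmap p x' = (\<lambda>i. dualmap p x i - \<beta> * tikhonov_grad p q F F' yd \<alpha>j x i) \<Longrightarrow>
      x' \<in> bregman_ball p (xa \<alpha>j) (d \<alpha>j)"
  proof (rule T.bregman_ball_invariant[OF \<alpha>j(1)])
    show "0 < d \<alpha>j" "bregman_ball p (xa \<alpha>j) (d \<alpha>j) \<subseteq> lp_cball p (xa \<alpha>j) (r \<alpha>j)"
      using d(1,5) \<alpha>j(1) by auto
    show "0 \<le> r \<alpha>j" "c * ((K + L * r \<alpha>j) * r \<alpha>j) \<le> \<gamma> * \<alpha>j"
      using radius[OF \<alpha>j(1)] by auto
  qed blast
  have cbar_nonneg: "0 \<le> cbar x" if x: "x \<in> lp p" for x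
  proof -
    have "0 \<le> cAbar" using p by (simp add: cAbar_eq)
    moreover have "0 \<le> r \<alpha>j" using radius[OF \<alpha>j(1)] by simp
    ultimately show ?thesis
      using T.tikhonov_linemin_le[OF \<alpha>j_pos, of x] T.K_nonneg L(1) s varrho(1) \<alpha>j_pos ct(1)
      by (simp add: cbar_eq[rule_format, OF x])
  qed
  define \<eta> where "\<eta> = lp_norm p (xa b - xa \<alpha>j)"
  have \<rho>_ge: "ct powr (1 / p) \<le> \<rho>" "2 * A powr (p - 1) + r \<alpha>j powr (p - 1) \<le> \<rho>"
  proof -
    show "ct powr (1 / p) \<le> \<rho>" by (simp add: \<rho>_eq)
    have "r \<alpha>j powr (p - 1) \<le> r \<alpha>0 powr (p - 1)"
      using p r_mono radius[OF \<alpha>j(1)] by (intro powr_mono2) auto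
    then show "2 * A powr (p - 1) + r \<alpha>j powr (p - 1) \<le> \<rho>" by (simp add: \<rho>_eq)
  qed
  have \<rho>0: "0 \<le> \<rho>" using \<rho>_ge(1) powr_ge_zero[of ct "1 / p"] by linarith
  note \<sigma> = T.minimizers_distance_le[OF b cA_eq \<sigma>_eq]
  have "\<rho> * \<eta> \<le> \<rho> * (\<sigma> * (\<alpha>0 * (1 - qbar)))"
    using \<sigma> mult_left_mono[OF shift \<sigma>(1)] \<rho>0 by (intro mult_left_mono) (auto simp: \<eta>_def)
  also have "\<dots> \<le> min (d \<alpha>s / 3) 1" using qbar(3) by (simp add: mult.assoc)
  finally have \<rho>\<eta>: "\<rho> * \<eta> \<le> d \<alpha>s / 3" "\<rho> * \<eta> \<le> 1" by auto
  \<comment> \<open>Monotonicity of \<open>d\<close> transfers the smallness condition from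
    \<open>\<alpha>s\<close> to the next parameter.\<close>
  have "d \<alpha>s \<le> d b"
    using d(3) b(1) by (auto simp: strict_mono_on_def le_less)
  with \<rho>\<eta> have \<rho>\<eta>_b: "\<rho> * \<eta> \<le> d b / 3" by simp
  show ?thesis
  proof (intro exI[of _ M] conjI allI impI M(1))
    fix x C kstar
    assume start: "x 0 \<in> bregman_ball p (xa \<alpha>j) (d \<alpha>j)"
      and iter: "dual_gradient_iteration p q (tikhonov_grad p q F F' yd \<alpha>j) \<gamma> cbar \<alpha>j M x"
      and C: "0 < C" "C \<le> \<gamma> * \<alpha>j * d \<alpha>j1 / (3 * r \<alpha>j)"
      and stop: "lp_norm q (tikhonov_grad p q F F' yd \<alpha>j (x kstar)) \<le> C"
    \<comment> \<open>\<open>M\<close> serves every point of the ball, so the one-step invariance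
      iterates. Where the gradient vanishes, division by zero makes \<open>\<beta>\<close>
      zero.\<close>
    have inv: "x k \<in> bregman_ball p (xa \<alpha>j) (d \<alpha>j)" for k
    proof (induction k)
      case (Suc k)
      define g where "g = tikhonov_grad p q F F' yd \<alpha>j (x k)"
      define \<beta> where "\<beta> = min (\<gamma> * cbar (x k) * \<alpha>j / (lp_norm q g)\<^sup>2) (1 / (2 * M))"
      have xk: "x k \<in> lp p" using Suc by (simp add: bregman_ball_def)
      have "0 \<le> \<beta>" "\<beta> \<le> 1 / (2 * M)"
        using cbar_nonneg[OF xk] T.\<gamma>_pos \<alpha>j_pos M(1) by (auto simp: \<beta>_def)
      moreover have "dualmap p (x (Suc k)) = (\<lambda>i. dualmap p (x k) i - \<beta> * g i)"
        using iter by (simp add: dual_gradient_iteration_def Let_def \<beta>_def g_def)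
      ultimately show ?case using M(2)[OF Suc] by (simp add: g_def)
    qed (rule start)
    have xk: "x kstar \<in> lp p" "lp_norm p (x kstar - xa \<alpha>j) \<le> r \<alpha>j"
      using inv[of kstar] d(5) \<alpha>j(1) by (auto simp: bregman_ball_def lp_cball_def)
    \<comment> \<open>The radius in the denominator of the bound on \<open>C\<close> cancels against
      the distance to the centre, leaving one third of \<open>d b\<close>.\<close>
    have "lp_norm q (tikhonov_grad p q F F' yd \<alpha>j (x kstar)) * r \<alpha>j
        \<le> \<gamma> * \<alpha>j * d b / (3 * r \<alpha>j) * r \<alpha>j"
      using stop C(2) radius[OF \<alpha>j(1)] by (intro mult_right_mono) (auto simp: b_def)
    also have "\<dots> = \<gamma> * \<alpha>j * (d b / 3)" using radius[OF \<alpha>j(1)] by simp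
    finally have g: "lp_norm q (tikhonov_grad p q F F' yd \<alpha>j (x kstar)) * r \<alpha>j
        \<le> \<gamma> * \<alpha>j * (d b / 3)" .
    show "x kstar \<in> bregman_ball p (xa \<alpha>j1) (d \<alpha>j1)"
      using T.next_bregman_ball[OF b(1) \<alpha>j(1) xk radius(2)[OF \<alpha>j(1)] g \<rho>_ge]
        \<rho>\<eta>_b \<rho>\<eta>(2) by (simp add: \<eta>_def b_def)
  qed
qed

end
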